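(* There is an algorithm which, given a simple LQCA $A=(\Sigma,q,N,\delta)$ with $|N|=r$, decides whether the columns $U_A(\cdot,c)$, $c\in\mathcal C_A$, of its time evolution operator are pairwise orthogonal, in time $O(n^2)$ in the algebraic model of computation, where $n=|\Sigma|^{r+1}$.
   Context: A linear quantum cellular automaton (LQCA) is a tuple $A=(\Sigma,q,N,\delta)$ where $\Sigma$ is a finite nonempty set of states, $N=(a_1,\dots,a_r)$ is a strictly increasing sequence of integers, $\delta:\Sigma^r\to\mathbb C^\Sigma$ satisfies $\|\delta(w)\|>0$ for all $w$, and $q\in\Sigma$ satisfies $[\delta(q,\dots,q)](x)=1$ if $x=q$ and $0$ otherwise. It is simple if $a_r-a_1=r-1$. The input is the table of $\delta$. In the algebraic model, complex numbers occupy unit space and arithmetic operations and comparisons take unit time. A configuration is a map $c:\mathbb Z\to\Sigma$ with $c_i\ne q$ for only finitely many $i$; $\mathcal C_A$ is the set of configurations. With $c_{i+N}=(c_{i+a_1},\dots,c_{i+a_r})$, $U_A(d,c)=\prod_{i\in\mathbb Z}[\delta(c_{i+N})](d_i)$; $U_A(\cdot,c)$ is the column $d\mapsto U_A(d,c)$ in $\ell_2(\mathcal C_A)$ with inner product $\langle u,v\rangle=\sum_d u(d)\overline{v(d)}$. *)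

theory Defs
  imports "HOL-Analysis.Analysis"
begin

text \<open>States are the naturals 0..<s (so Sigma = {..<s}); a neighbourhood is a list of
  integers; the local rule delta maps a word (list of states of length r) and a state to a
  complex amplitude.\<close>

definition lqca :: "nat \<Rightarrow> nat \<Rightarrow> int list \<Rightarrow> (nat list \<Rightarrow> nat \<Rightarrow> complex) \<Rightarrow> bool" where
  "lqca s q N \<delta> \<longleftrightarrow>
     0 < s \<and> q < s \<and> sorted_wrt (<) N \<and>
     (\<forall>w. length w = length N \<and> set w \<subseteq> {..<s} \<longrightarrow>
          sqrt (\<Sum>x<s. (cmod (\<delta> w x))^2) > 0) \<and>
     (\<forall>x<s. \<delta> (replicate (length N) q) x = (if x = q then 1 else 0))"

definition simple_nbhd :: "int list \<Rightarrow> bool" where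
  "simple_nbhd N \<longleftrightarrow> N \<noteq> [] \<and> last N - hd N = int (length N) - 1"

definition is_config :: "nat \<Rightarrow> nat \<Rightarrow> (int \<Rightarrow> nat) \<Rightarrow> bool" where
  "is_config s q c \<longleftrightarrow> (\<forall>i. c i < s) \<and> finite {i. c i \<noteq> q}"

definition configs :: "nat \<Rightarrow> nat \<Rightarrow> (int \<Rightarrow> nat) set" where
  "configs s q = {c. is_config s q c}"

text \<open>The local factor at cell i, and the infinite product U_A(d,c) = prod_i delta(c_{i+N})(d_i).
  All but finitely many factors equal 1 unless infinitely many factors are 0 (a factor that
  is neither 1 nor 0 only occurs at finitely many cells when c is a configuration), so the
  infinite product is the finite product of the non-unit factors if there are finitely many,
  and 0 otherwise.\<close>

definition loc_factor :: "int list \<Rightarrow> (nat list \<Rightarrow> nat \<Rightarrow> complex) \<Rightarrow> (int \<Rightarrow> nat) \<Rightarrow> (int \<Rightarrow> nat) \<Rightarrow> int \<Rightarrow> complex" where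
  "loc_factor N \<delta> d c i = \<delta> (map (\<lambda>a. c (i + a)) N) (d i)"

definition U_op :: "int list \<Rightarrow> (nat list \<Rightarrow> nat \<Rightarrow> complex) \<Rightarrow> (int \<Rightarrow> nat) \<Rightarrow> (int \<Rightarrow> nat) \<Rightarrow> complex" where
  "U_op N \<delta> d c =
     (if finite {i. loc_factor N \<delta> d c i \<noteq> 1}
      then (\<Prod>i\<in>{i. loc_factor N \<delta> d c i \<noteq> 1}. loc_factor N \<delta> d c i)
      else 0)"

definition columns_orthogonal :: "nat \<Rightarrow> nat \<Rightarrow> int list \<Rightarrow> (nat list \<Rightarrow> nat \<Rightarrow> complex) \<Rightarrow> bool" where
  "columns_orthogonal s q N \<delta> \<longleftrightarrow>
     (\<forall>c \<in> configs s q. \<forall>c' \<in> configs s q. c \<noteq> c' \<longrightarrow>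
        ((\<lambda>d. U_op N \<delta> d c * cnj (U_op N \<delta> d c')) has_sum 0) (configs s q))"

text \<open>Two register files: integer (address) registers and real registers.  A complex number
  is stored as two real registers (real and imaginary part).  Each instruction takes unit time;
  real arithmetic (+,-,*,/) and comparisons take unit time; constants are integers.  Integer
  registers support addition, subtraction, comparison and indirect addressing.\<close>

datatype instr =
    ISet nat int
  | IAdd nat nat nat
  | ISub nat nat nat
  | ILoad nat nat
  | IStore nat nat
  | RSet nat int
  | RAdd nat nat nat
  | RSub nat nat nat
  | RMul nat nat nat
  | RDiv nat nat nat
  | RLoad nat nat
  | RStore nat nat
  | IfILe nat nat nat
  | IfRLe nat nat nat
  | Halt

record mstate =
  pc :: nat
  ireg :: "nat \<Rightarrow> int"
  rreg :: "nat \<Rightarrow> real"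

definition halted :: "instr list \<Rightarrow> mstate \<Rightarrow> bool" where
  "halted P st \<longleftrightarrow> pc st \<ge> length P \<or> P ! pc st = Halt"

fun exec_instr :: "instr \<Rightarrow> mstate \<Rightarrow> mstate" where
  "exec_instr (ISet i k) st = st\<lparr>pc := Suc (pc st), ireg := (ireg st)(i := k)\<rparr>"
| "exec_instr (IAdd i j k) st = st\<lparr>pc := Suc (pc st), ireg := (ireg st)(i := ireg st j + ireg st k)\<rparr>"
| "exec_instr (ISub i j k) st = st\<lparr>pc := Suc (pc st), ireg := (ireg st)(i := ireg st j - ireg st k)\<rparr>"
| "exec_instr (ILoad i j) st = st\<lparr>pc := Suc (pc st), ireg := (ireg st)(i := ireg st (nat (ireg st j)))\<rparr>"
| "exec_instr (IStore i j) st = st\<lparr>pc := Suc (pc st), ireg := (ireg st)(nat (ireg st i) := ireg st j)\<rparr>"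
| "exec_instr (RSet i k) st = st\<lparr>pc := Suc (pc st), rreg := (rreg st)(i := of_int k)\<rparr>"
| "exec_instr (RAdd i j k) st = st\<lparr>pc := Suc (pc st), rreg := (rreg st)(i := rreg st j + rreg st k)\<rparr>"
| "exec_instr (RSub i j k) st = st\<lparr>pc := Suc (pc st), rreg := (rreg st)(i := rreg st j - rreg st k)\<rparr>"
| "exec_instr (RMul i j k) st = st\<lparr>pc := Suc (pc st), rreg := (rreg st)(i := rreg st j * rreg st k)\<rparr>"
| "exec_instr (RDiv i j k) st = st\<lparr>pc := Suc (pc st), rreg := (rreg st)(i := rreg st j / rreg st k)\<rparr>"
| "exec_instr (RLoad i j) st = st\<lparr>pc := Suc (pc st), rreg := (rreg st)(i := rreg st (nat (ireg st j)))\<rparr>"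
| "exec_instr (RStore i j) st = st\<lparr>pc := Suc (pc st), rreg := (rreg st)(nat (ireg st i) := rreg st j)\<rparr>"
| "exec_instr (IfILe i j t) st = st\<lparr>pc := (if ireg st i \<le> ireg st j then t else Suc (pc st))\<rparr>"
| "exec_instr (IfRLe i j t) st = st\<lparr>pc := (if rreg st i \<le> rreg st j then t else Suc (pc st))\<rparr>"
| "exec_instr Halt st = st"

definition step :: "instr list \<Rightarrow> mstate \<Rightarrow> mstate" where
  "step P st = (if halted P st then st else exec_instr (P ! pc st) st)"

definition digits :: "nat \<Rightarrow> nat \<Rightarrow> nat \<Rightarrow> nat list" where
  "digits s r m = map (\<lambda>k. (m div s ^ (r - 1 - k)) mod s) [0..<r]"

text \<open>Integer registers 0..3 hold s = |Sigma|, r = |N|, q and a_1; the table of delta is stored in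
  the real registers: entry number m = idx(w) * s + x holds delta(w)(x), real part in register
  2m and imaginary part in register 2m+1, for all words w in Sigma^r and x in Sigma.\<close>
definition init_state :: "nat \<Rightarrow> nat \<Rightarrow> int list \<Rightarrow> (nat list \<Rightarrow> nat \<Rightarrow> complex) \<Rightarrow> mstate" where
  "init_state s q N \<delta> =
     \<lparr> pc = 0,
       ireg = (\<lambda>_. 0)(0 := int s, 1 := int (length N), 2 := int q, 3 := hd N),
       rreg = (\<lambda>j. if j < 2 * s ^ (length N + 1) then
                     (let m = j div 2; v = \<delta> (digits s (length N) (m div s)) (m mod s)
                      in if even j then Re v else Im v)
                   else 0) \<rparr>"

end

(*
  Up to a shift, the inner product of the columns of c and c' is the product over all cells i
  of the inner products of the local amplitude vectors at the r-letter windows of c and c'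
  at i. So the columns fail to be orthogonal exactly if there are c \<noteq> c' all of whose
  window pairs are non-orthogonal. Such a pair of configurations is a walk in the graph on
  pairs of words, where a non-orthogonal pair has an edge to every pair obtained by shifting
  both words by one letter; the walk starts and ends on the diagonal and leaves it in between.
  All diagonal pairs are non-orthogonal and mutually connected, hence such a walk exists iff
  some non-orthogonal pair of different words reachable from the diagonal has a diagonal
  successor. A breadth-first search decides this: it visits at most s^(2r) pairs, and each
  costs O(s) for the inner product and O(s^2) for its successors.
*)
theory Submission
  imports Defs
begin

section \<open>Orthogonality as reachability in the pair graph\<close>

text \<open>The delicate points are on the side of the machine. It adds, subtracts and compares
  integers, but it neither multiplies nor divides them and has no equality test. Words are therefore
  numbers in base \<open>s\<close>, the same numbers that index the table of \<delta>, and moving a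
  window means multiplying by \<open>s\<close>, reducing modulo \<open>s ^ r\<close> and adding a
  letter. The first two are done by at most \<open>s\<close> additions or subtractions each, so they
  fit into the budget of one visit. The product of the first component with \<open>s ^ r\<close>,
  needed to address the mark of a pair, travels with the pair for the same reason. The preparation
  is the other threat to the bound. Computing \<open>s ^ r\<close> takes time of order
  \<open>r * s\<close>, which is O(n^2) because \<open>r\<close> is at most \<open>s ^ r\<close> as
  soon as there are two letters. With one letter n is 1 while \<open>r\<close> is arbitrary, so that
  case has to be answered in constant time, before any loop whose length depends on
  \<open>r\<close>.\<close>

fun window_code :: "nat \<Rightarrow> (int \<Rightarrow> nat) \<Rightarrow> int \<Rightarrow> nat \<Rightarrow> nat" where
  "window_code s c i 0 = 0"
| "window_code s c i (Suc k) = window_code s c i k * s + c (i + int k)"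

lemma window_code_cong:
  "(\<And>j. i \<le> j \<Longrightarrow> j < i + int k \<Longrightarrow> c j = c' j) \<Longrightarrow> window_code s c i k = window_code s c' i k"
  by (induction k) auto

lemma window_code_shift: "window_code s (\<lambda>j. c (j + a)) i k = window_code s c (i + a) k"
  by (induction k) (auto simp: algebra_simps)

lemma window_code_less:
  assumes "\<And>j. c j < s"
  shows "window_code s c i k < s ^ k"
proof (induction k)
  case (Suc k)
  then have "window_code s c i k * s + s \<le> s ^ k * s"
    by (metis Suc_leI add.commute mult_Suc mult_le_mono1)
  then show ?case using assms[of "i + int k"] by (simp add: mult.commute)
qed simp

lemma window_code_append:
  "window_code s c i (m + k) = window_code s c i m * s ^ k + window_code s c (i + int m) k"
  by (induction k) (auto simp: algebra_simps)

text \<open>Splitting the window behind letter \<open>k\<close> leaves \<open>r - 1 - k\<close>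
  lower digits. The division drops them, and the remainder isolates the last digit of what is
  left.\<close>

lemma window_code_digit:
  assumes c: "\<And>j. c j < s" and "k < r"
  shows "(window_code s c i r div s ^ (r - 1 - k)) mod s = c (i + int k)"
proof -
  define j where "j = r - 1 - k"
  have r: "r = Suc k + j" using \<open>k < r\<close> by (simp add: j_def)
  have "window_code s c i r = window_code s c i (Suc k) * s ^ j + window_code s c (i + int (Suc k)) j"
    unfolding r by (rule window_code_append)
  moreover have "window_code s c (i + int (Suc k)) j < s ^ j"
    using c by (rule window_code_less)
  ultimately have "window_code s c i r div s ^ j = window_code s c i (Suc k)"
    using \<open>k < r\<close> c[of 0] by (simp add: div_mult_self3 del: window_code.simps)
  then show ?thesis using c[of "i + int k"] by (simp add: j_def)
qed

text \<open>Links the codes to the letter order of \<open>digits\<close>, hence to the index under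
  which the machine stores \<delta>.\<close>

lemma digits_window_code:
  assumes "\<And>j. c j < s"
  shows "digits s r (window_code s c i r) = map (\<lambda>k. c (i + int k)) [0..<r]"
  unfolding digits_def using window_code_digit[OF assms] by simp

lemma window_code_eqD:
  assumes "\<And>j. c j < s" "\<And>j. c' j < s" "window_code s c i r = window_code s c' i r" "i \<le> j" "j < i + int r"
  shows "c j = c' j"
proof -
  obtain k where "j = i + int k" "k < r"
    using assms(4,5) by (metis add.commute add_less_cancel_left nat_int of_nat_less_iff zle_iff_zadd)
  then show ?thesis using window_code_digit[of c s k r i] window_code_digit[of c' s k r i] assms by metis
qed

text \<open>The factor \<open>s\<close> lifts the leading letter to weight \<open>s ^ r\<close>,
  where the remainder removes it; a zero digit is left for the incoming letter. Equal residues of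
  two codes thus mean agreement behind the first letter.\<close>

lemma window_code_mult_mod:
  assumes "\<And>j. c j < s" "0 < r"
  shows "window_code s c i r * s mod s ^ r = window_code s c (i + 1) (r - 1) * s"
proof -
  obtain k where r: "r = Suc k" using \<open>0 < r\<close> gr0_implies_Suc by blast
  have s: "s > 0" using assms(1)[of 0] by simp
  have "window_code s c i r = c i * s ^ k + window_code s c (i + 1) k"
    using window_code_append[of s c i 1 k] by (simp add: r)
  then have "window_code s c i r * s = window_code s c (i + 1) k * s + c i * s ^ r"
    by (simp add: r algebra_simps)
  moreover have "window_code s c (i + 1) k * s < s ^ r"
    using window_code_less[of c s "i+1" k] assms(1) s by (simp add: r mult.commute)
  ultimately show ?thesis by (simp add: r)
qed

lemma window_code_next:
  assumes "\<And>j. c j < s" "0 < r"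
  shows "window_code s c (i + 1) r = window_code s c i r * s mod s ^ r + c (i + int r)"
proof -
  obtain k where r: "r = Suc k" using \<open>0 < r\<close> gr0_implies_Suc by blast
  have "window_code s c (i + 1) r = window_code s c (i + 1) (r - 1) * s + c (i + int r)"
    by (simp add: r algebra_simps)
  then show ?thesis using window_code_mult_mod[of c s r i] assms by simp
qed

lemma window_code_surj:
  assumes "a < s ^ r" "0 < s" "q < s"
  shows "\<exists>c. (\<forall>j. c j < s) \<and> (\<forall>j. j \<ge> int r \<or> j < 0 \<longrightarrow> c j = q) \<and> window_code s c 0 r = a"
proof -
  define c where "c j = (if j \<ge> int r \<or> j < 0 then q else (a div s ^ (r - 1 - nat j)) mod s)" for j
  \<comment> \<open>The first \<open>k\<close> letters form the code \<open>a\<close> without its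
    \<open>r - k\<close> lowest digits; the claim for \<open>k = r\<close> alone would not support
    the induction.\<close>
  have "window_code s c 0 k = a div s ^ (r - k)" if "k \<le> r" for k
    using that
  proof (induction k)
    case 0
    then show ?case using assms by simp
  next
    case (Suc k)
    let ?b = "a div s ^ (r - 1 - k)"
    have "r - k = Suc (r - 1 - k)" using Suc.prems by simp
    then have "a div s ^ (r - k) = ?b div s"
      by (metis div_mult2_eq mult.commute power_Suc)
    moreover have "c (0 + int k) = ?b mod s" using Suc.prems by (simp add: c_def)
    ultimately have "window_code s c 0 (Suc k) = ?b div s * s + ?b mod s"
      using Suc by (simp only: window_code.simps)
    then show ?case by (simp only: div_mult_mod_eq) simp
  qed
  then have "window_code s c 0 r = a" by simp
  moreover have "c j < s" for j using assms by (simp add: c_def)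
  ultimately show ?thesis by (intro exI[of _ c]) (auto simp: c_def)
qed

section \<open>The pair graph and its walks as pairs of configurations\<close>

definition word_inner :: "nat \<Rightarrow> nat \<Rightarrow> (nat list \<Rightarrow> nat \<Rightarrow> complex) \<Rightarrow> nat \<Rightarrow> nat \<Rightarrow> complex" where
  "word_inner s r \<delta> a b = (\<Sum>x<s. \<delta> (digits s r a) x * cnj (\<delta> (digits s r b) x))"

text \<open>Words of length \<open>r\<close> are coded in base \<open>s\<close>, most significant letter first, so moving the window
  one cell to the right sends \<open>a\<close> to \<open>a * s mod s ^ r + x\<close>, where \<open>x\<close> is the letter that enters.\<close>

inductive pair_reach :: "nat \<Rightarrow> nat \<Rightarrow> (nat list \<Rightarrow> nat \<Rightarrow> complex) \<Rightarrow> nat \<Rightarrow> nat \<Rightarrow> bool" for s r \<delta> where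
  diag: "a < s ^ r \<Longrightarrow> pair_reach s r \<delta> a a"
| step: "pair_reach s r \<delta> a b \<Longrightarrow> word_inner s r \<delta> a b \<noteq> 0 \<Longrightarrow> x < s \<Longrightarrow> y < s \<Longrightarrow>
    pair_reach s r \<delta> (a * s mod s ^ r + x) (b * s mod s ^ r + y)"

text \<open>What the pair graph depends on: the position of a simple neighbourhood shifts all
  windows by a common offset, so \<open>N\<close> enters through its length alone.\<close>

locale simple_rule =
  fixes s q r :: nat and \<delta> :: "nat list \<Rightarrow> nat \<Rightarrow> complex"
  assumes q: "q < s" and r: "0 < r"
    and norm_pos: "\<And>w. length w = r \<Longrightarrow> set w \<subseteq> {..<s} \<Longrightarrow> sqrt (\<Sum>x<s. (cmod (\<delta> w x))^2) > 0"
    and quiescent: "\<And>x. x < s \<Longrightarrow> \<delta> (replicate r q) x = (if x = q then 1 else 0)"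
begin

lemma s_pos: "0 < s" using q by simp

lemma length_digits: "length (digits s r a) = r"
  by (simp add: digits_def)

lemma set_digits: "set (digits s r a) \<subseteq> {..<s}"
  using s_pos by (auto simp: digits_def)

text \<open>A vector paired with itself gives its squared norm, which \<open>norm_pos\<close> makes
  positive. Hence cells with equal windows never interrupt a walk.\<close>

lemma word_inner_diag: "word_inner s r \<delta> a a \<noteq> 0"
proof -
  let ?S = "\<Sum>x<s. (cmod (\<delta> (digits s r a) x))^2"
  have "word_inner s r \<delta> a a = of_real ?S"
    by (simp add: word_inner_def complex_norm_square del: of_real_power)
  moreover have "?S \<noteq> 0" using norm_pos[OF length_digits set_digits, of a] by auto
  ultimately show ?thesis using of_real_eq_0_iff by metis
qed

lemma is_config_quiescent_outside:
  assumes "is_config s q c"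
  shows "\<exists>B::int. \<forall>j. j < -B \<or> B < j \<longrightarrow> c j = q"
proof -
  have "finite {i. c i \<noteq> q}" using assms by (simp add: is_config_def)
  then have "finite (abs ` {i. c i \<noteq> q})" by simp
  then obtain B where "\<forall>x\<in>abs ` {i. c i \<noteq> q}. x \<le> B"
    using bdd_above_finite unfolding bdd_above_def by blast
  then show ?thesis by (intro exI[of _ B]) fastforce
qed

lemma is_configI:
  assumes "\<And>j. c j < s" "\<And>j. j < A \<or> B < j \<Longrightarrow> c j = q"
  shows "is_config s q c"
proof -
  have "{i. c i \<noteq> q} \<subseteq> {A..B}" using assms(2) by force
  then show ?thesis using assms(1) finite_subset by (auto simp: is_config_def)
qed

text \<open>The windows start at cell \<open>i\<close> itself. The offset of the neighbourhood is
  added later, where it only renumbers the cells.\<close>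

definition nonorth_at :: "(int \<Rightarrow> nat) \<Rightarrow> (int \<Rightarrow> nat) \<Rightarrow> int \<Rightarrow> bool" where
  "nonorth_at c c' i \<longleftrightarrow> word_inner s r \<delta> (window_code s c i r) (window_code s c' i r) \<noteq> 0"

text \<open>The walk is written onto the tape so that its current pair stands at cell 0, its past
  lies to the left, and everything to the right of the window is still quiescent. A diagonal start
  is one configuration taken twice.\<close>

lemma pair_reach_configs:
  assumes "pair_reach s r \<delta> a b"
  shows "\<exists>c c'. is_config s q c \<and> is_config s q c' \<and> (\<forall>j \<ge> int r. c j = q \<and> c' j = q) \<and>
     window_code s c 0 r = a \<and> window_code s c' 0 r = b \<and> (\<forall>i<0. nonorth_at c c' i)"
  using assms
proof induction
  case (diag a)
  obtain c where c: "\<And>j. c j < s" "\<And>j. j \<ge> int r \<or> j < 0 \<Longrightarrow> c j = q" "window_code s c 0 r = a"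
    using window_code_surj[OF diag s_pos q] by auto
  then have "is_config s q c" by (intro is_configI[of c 0 "int r"]) auto
  then show ?case using c word_inner_diag by (intro exI[of _ c]) (auto simp: nonorth_at_def)
next
  case (step a b x y)
  then obtain c c' where c: "is_config s q c" "is_config s q c'"
    "window_code s c 0 r = a" "window_code s c' 0 r = b" "\<And>i. i < 0 \<Longrightarrow> nonorth_at c c' i" by auto
  \<comment> \<open>One step of the walk: the old configuration moves one cell to the left, and the
    incoming letter \<open>z\<close> is written at \<open>r - 1\<close>, the last cell of the window
    at 0.\<close>
  define ext where "ext e z j = (if j < int r - 1 then e (j + 1) else if j = int r - 1 then z else q)"
    for e :: "int \<Rightarrow> nat" and z j
  have cfg: "is_config s q (ext e z)" if e: "is_config s q e" and z: "z < s" for e z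
  proof -
    obtain B where B: "\<forall>j. j < -B \<or> B < j \<longrightarrow> e j = q" using is_config_quiescent_outside[OF e] by blast
    have "ext e z j = q" if "j < min (- B) 0 - 1 \<or> max B (int r) < j" for j
      using B that r by (auto simp: ext_def)
    moreover have "ext e z j < s" for j using e z q by (auto simp: ext_def is_config_def)
    ultimately show ?thesis
      by (intro is_configI[of "ext e z" "min (- B) 0 - 1" "max B (int r)"]) auto
  qed
  have win: "window_code s (ext e z) i r = window_code s e (i + 1) r" if "i < 0" for e z i
  proof -
    have "window_code s (ext e z) i r = window_code s (\<lambda>j. e (j + 1)) i r"
      using that by (intro window_code_cong) (auto simp: ext_def)
    then show ?thesis by (simp add: window_code_shift)
  qed
  have win0: "window_code s (ext e z) 0 r = window_code s e 0 r * s mod s ^ r + z"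
    if e: "is_config s q e" and z: "z < s" for e z
  proof -
    have "window_code s (ext e z) (-1 + 1) r
        = window_code s (ext e z) (-1) r * s mod s ^ r + ext e z (-1 + int r)"
      using cfg[OF e z] r by (intro window_code_next) (auto simp: is_config_def)
    then show ?thesis using win[of "-1" e z] by (simp add: ext_def)
  qed
  \<comment> \<open>The window at \<open>-1\<close> holds the previous pair, whose non-orthogonality
    is the condition for taking the edge. The windows further left come from the induction
    hypothesis.\<close>
  have "nonorth_at (ext c x) (ext c' y) i" if "i < 0" for i
    using c(3-5) step.hyps(2) that by (cases "i = -1") (auto simp: nonorth_at_def win)
  moreover have "ext e z j = q" if "j \<ge> int r" for e z j using that by (simp add: ext_def)
  ultimately show ?case
    using cfg[OF c(1) step.hyps(3)] cfg[OF c(2) step.hyps(4)]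
      win0[OF c(1) step.hyps(3)] win0[OF c(2) step.hyps(4)] c(3,4) by blast
qed

text \<open>The last condition says that the two words agree except in their first letter: one step
  later the pair can be back on the diagonal.\<close>

definition bad_pair :: "nat \<Rightarrow> nat \<Rightarrow> bool" where
  "bad_pair a b \<longleftrightarrow> a \<noteq> b \<and> word_inner s r \<delta> a b \<noteq> 0 \<and> a * s mod s ^ r = b * s mod s ^ r"

text \<open>With the bad pair at cell 0, both configurations agree from cell 1 on: inside the window
  by equality of the residues, beyond it because both are quiescent. So windows to the right of 0
  are equal, and those to the left are covered by the walk.\<close>

lemma configs_of_bad_pair:
  assumes "pair_reach s r \<delta> a b" "bad_pair a b"
  shows "\<exists>c c'. is_config s q c \<and> is_config s q c' \<and> c \<noteq> c' \<and> (\<forall>i. nonorth_at c c' i)"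
proof -
  obtain c c' where c: "is_config s q c" "is_config s q c'"
    and tail: "\<And>j. j \<ge> int r \<Longrightarrow> c j = q \<and> c' j = q"
    and ab: "window_code s c 0 r = a" "window_code s c' 0 r = b"
    and neg: "\<And>i. i < 0 \<Longrightarrow> nonorth_at c c' i"
    using pair_reach_configs[OF assms(1)] by auto
  have lt: "\<And>j. c j < s" "\<And>j. c' j < s" using c by (auto simp: is_config_def)
  have "window_code s c 1 (r - 1) * s = window_code s c' 1 (r - 1) * s"
    using window_code_mult_mod[of c s r 0] window_code_mult_mod[of c' s r 0] lt r ab assms(2)
    by (simp add: bad_pair_def)
  then have "window_code s c 1 (r - 1) = window_code s c' 1 (r - 1)" using s_pos by simp
  then have "c j = c' j" if "1 \<le> j" "j < int r" for j
    using window_code_eqD[of c s c' 1 "r - 1" j] lt that r by (simp add: of_nat_diff)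
  then have eq: "c j = c' j" if "1 \<le> j" for j
    using that tail by (cases "j < int r") auto
  have "nonorth_at c c' i" for i
  proof -
    have "window_code s c i r = window_code s c' i r" if "i > 0"
      using that eq by (intro window_code_cong) auto
    then show ?thesis using neg[of i] assms(2) ab word_inner_diag
      by (cases i "0::int" rule: linorder_cases) (auto simp: nonorth_at_def bad_pair_def)
  qed
  moreover have "c \<noteq> c'" using ab assms(2) by (auto simp: bad_pair_def)
  ultimately show ?thesis using c by blast
qed

text \<open>The windows, read from left to right, form the walk. The bad pair stands at the last
  cell where the configurations differ: this cell is the first letter of its window, and the
  remaining letters agree.\<close>

lemma bad_pair_of_configs:
  assumes c: "is_config s q c" "is_config s q c'" "c \<noteq> c'" and path: "\<And>i. nonorth_at c c' i"
  shows "\<exists>a b. pair_reach s r \<delta> a b \<and> bad_pair a b"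
proof -
  have lt: "\<And>j. c j < s" "\<And>j. c' j < s" using c by (auto simp: is_config_def)
  obtain B where B: "\<And>j. j < -B \<or> B < j \<Longrightarrow> c j = q" using is_config_quiescent_outside[OF c(1)] by blast
  obtain B' where B': "\<And>j. j < -B' \<or> B' < j \<Longrightarrow> c' j = q" using is_config_quiescent_outside[OF c(2)] by blast
  \<comment> \<open>The window at \<open>i0\<close> ends at cell \<open>- max B B' - 1\<close>, so
    it is quiescent in both configurations and the walk starts on the diagonal.\<close>
  define i0 where "i0 = - max B B' - int r"
  have reach: "pair_reach s r \<delta> (window_code s c i r) (window_code s c' i r)" if "i0 \<le> i" for i
    using that
  proof (induction i rule: int_ge_induct)
    case base
    have "window_code s c i0 r = window_code s c' i0 r"
    proof (rule window_code_cong)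
      fix j assume "i0 \<le> j" "j < i0 + int r"
      then show "c j = c' j" using B[of j] B'[of j] by (auto simp: i0_def max_def split: if_splits)
    qed
    then show ?case using window_code_less[of c s i0 r] lt pair_reach.diag by simp
  next
    case (step i)
    then show ?case using window_code_next[of c s r i] window_code_next[of c' s r i] lt r path[of i]
      by (simp add: nonorth_at_def pair_reach.step)
  qed
  let ?D = "{j. c j \<noteq> c' j}"
  have "?D \<subseteq> {j. c j \<noteq> q} \<union> {j. c' j \<noteq> q}" by auto
  moreover have "finite \<dots>" using c by (simp add: is_config_def)
  ultimately have fin: "finite ?D" using finite_subset by blast
  have ne: "?D \<noteq> {}" using c(3) by auto
  define m where "m = Max ?D"
  have m: "c m \<noteq> c' m" using Max_in[OF fin ne] by (simp add: m_def)
  have eq: "c j = c' j" if "j > m" for j using Max_ge[OF fin, of j] that by (auto simp: m_def)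
  have "i0 \<le> m"
  proof (rule ccontr)
    assume "\<not> i0 \<le> m"
    then show False using m B[of m] B'[of m] by (auto simp: i0_def max_def split: if_splits)
  qed
  moreover have "window_code s c m r \<noteq> window_code s c' m r"
    using window_code_eqD[of c s c' m r m] lt m r by auto
  moreover have "window_code s c (m + 1) (r - 1) = window_code s c' (m + 1) (r - 1)"
    using eq by (intro window_code_cong) auto
  ultimately show ?thesis
    using reach[of m] path[of m] window_code_mult_mod[of c s r m] window_code_mult_mod[of c' s r m] lt r
    unfolding bad_pair_def nonorth_at_def by metis
qed

section \<open>Factorisation of the inner product of two columns\<close>

text \<open>The inner product of two columns is the product over the cells of the inner products of
  the local amplitude vectors; away from a finite interval all factors are 1.\<close>

lemma columns_inner_product:
  fixes a1 :: int
  assumes N: "N = map (\<lambda>k. a1 + int k) [0..<r]"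
    and c: "is_config s q c" "is_config s q c'"
  shows "((\<lambda>d. U_op N \<delta> d c * cnj (U_op N \<delta> d c')) has_sum 0) (configs s q) \<longleftrightarrow>
    (\<exists>i. \<not> nonorth_at c c' i)"
proof -
  define amp where "amp e i x = \<delta> (digits s r (window_code s e (i + a1) r)) x" for e i x
  have factor: "loc_factor N \<delta> d e i = amp e i (d i)" if "is_config s q e" for e d i
    using digits_window_code[of e s r "i + a1"] that
    by (simp add: loc_factor_def amp_def N is_config_def comp_def algebra_simps)
  obtain B where B: "\<And>j. j < -B \<or> B < j \<Longrightarrow> c j = q" using is_config_quiescent_outside[OF c(1)] by blast
  obtain B' where B': "\<And>j. j < -B' \<or> B' < j \<Longrightarrow> c' j = q" using is_config_quiescent_outside[OF c(2)] by blast
  \<comment> \<open>Contains all cells whose window, from \<open>i + a1\<close> to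
    \<open>i + a1 + r - 1\<close>, may meet a non-quiescent letter: left of \<open>I\<close> the
    window ends before \<open>- max B B'\<close>, right of it the window starts after
    \<open>max B B'\<close>.\<close>
  define I where "I = {- max B B' - a1 - int r .. max B B' - a1}"
  have "finite I" by (simp add: I_def)
  have q_window: "window_code s e (i + a1) r = window_code s (\<lambda>_. q) (i + a1) r"
    if "e = c \<or> e = c'" "i \<notin> I" for e i
  proof (rule window_code_cong)
    fix j assume "i + a1 \<le> j" "j < i + a1 + int r"
    then have "j < - max B B' \<or> max B B' < j" using that(2) by (auto simp: I_def)
    then have "c j = q" "c' j = q" using B[of j] B'[of j] by linarith+
    then show "e j = q" using that(1) by blast
  qed
  have q_amp: "amp e i x = (if x = q then 1 else 0)"
    if "e = c \<or> e = c'" "i \<notin> I" "x < s" for e i x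
  proof -
    have "digits s r (window_code s (\<lambda>_. q) (i + a1) r) = replicate r q"
      using digits_window_code[of "\<lambda>_. q" s r "i + a1"] q by (simp add: map_replicate_const)
    then show ?thesis using that quiescent by (simp add: amp_def q_window)
  qed
  \<comment> \<open>Outside \<open>I\<close> both amplitude vectors are the unit vector at
    \<open>q\<close>, so only these configurations can have a nonzero entry. The infinite sum
    becomes finite.\<close>
  define F where "F = {d. (\<forall>j. d j < s) \<and> (\<forall>j. j \<notin> I \<longrightarrow> d j = q)}"
  have "F \<subseteq> configs s q"
  proof
    fix d assume "d \<in> F"
    moreover from this have "{i. d i \<noteq> q} \<subseteq> I" by (auto simp: F_def)
    ultimately show "d \<in> configs s q"
      using \<open>finite I\<close> finite_subset by (auto simp: configs_def is_config_def F_def)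
  qed
  have U: "U_op N \<delta> d e = (\<Prod>i\<in>I. amp e i (d i))" if e: "e = c \<or> e = c'" and d: "d \<in> F" for d e
  proof -
    have sub: "{i. amp e i (d i) \<noteq> 1} \<subseteq> I"
    proof (rule ccontr)
      assume "\<not> ?thesis"
      then obtain i where "i \<notin> I" "amp e i (d i) \<noteq> 1" by auto
      then show False using q_amp[OF e, of i "d i"] d by (auto simp: F_def)
    qed
    then have "(\<Prod>i\<in>{i. amp e i (d i) \<noteq> 1}. amp e i (d i)) = (\<Prod>i\<in>I. amp e i (d i))"
      using \<open>finite I\<close> by (intro prod.mono_neutral_left) auto
    moreover have "finite {i. amp e i (d i) \<noteq> 1}" using sub \<open>finite I\<close> finite_subset by blast
    ultimately show ?thesis using factor e c by (auto simp: U_op_def)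
  qed
  have U0: "U_op N \<delta> d c = 0" if d: "d \<in> configs s q - F" for d
  proof -
    obtain j where "j \<notin> I" "d j \<noteq> q" "d j < s"
      using d by (auto simp: F_def configs_def is_config_def)
    then have "loc_factor N \<delta> d c j = 0" using factor c q_amp[of c j "d j"] by simp
    then have "\<exists>i\<in>{i. loc_factor N \<delta> d c i \<noteq> 1}. loc_factor N \<delta> d c i = 0"
      by (intro bexI[of _ j]) auto
    \<comment> \<open>Both branches of \<open>U_op\<close> give 0: a finite product contains the
      zero factor, and infinitely many non-unit factors yield the default value.\<close>
    then show ?thesis unfolding U_op_def by (simp add: prod_zero del: mem_Collect_eq)
  qed
  define g where "g d i = amp c i (d i) * cnj (amp c' i (d i))" for d :: "int \<Rightarrow> nat" and i
  define ext where "ext h = (\<lambda>j. if j \<in> I then h j else q)" for h :: "int \<Rightarrow> nat"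
  \<comment> \<open>Sums over \<open>F\<close> turn into sums over all functions from
    \<open>I\<close> to the letters, the form in which a product of sums expands.\<close>
  have bij: "bij_betw ext (PiE I (\<lambda>_. {..<s})) F"
  proof (rule bij_betw_byWitness[where f' = "\<lambda>d. restrict d I"])
    show "\<forall>h\<in>PiE I (\<lambda>_. {..<s}). restrict (ext h) I = h"
    proof
      fix h assume "h \<in> PiE I (\<lambda>_. {..<s})"
      then show "restrict (ext h) I = h"
        by (intro HOL.ext) (auto simp: ext_def dest: PiE_arb)
    qed
    show "\<forall>d\<in>F. ext (restrict d I) = d"
    proof
      fix d assume "d \<in> F"
      then have "\<And>j. j \<notin> I \<Longrightarrow> d j = q" by (simp add: F_def)
      then show "ext (restrict d I) = d" by (intro HOL.ext) (simp add: ext_def)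
    qed
    show "ext ` PiE I (\<lambda>_. {..<s}) \<subseteq> F"
    proof
      fix d assume "d \<in> ext ` PiE I (\<lambda>_. {..<s})"
      then obtain h where h: "d = ext h" "h \<in> PiE I (\<lambda>_. {..<s})" by blast
      have "h j < s" if "j \<in> I" for j using h(2) that by (metis PiE_mem lessThan_iff)
      then show "d \<in> F" using q by (simp add: h(1) ext_def F_def)
    qed
    show "(\<lambda>d. restrict d I) ` F \<subseteq> PiE I (\<lambda>_. {..<s})"
    proof
      fix h assume "h \<in> (\<lambda>d. restrict d I) ` F"
      then obtain d where h: "h = restrict d I" "d \<in> F" by blast
      then have "\<And>j. d j < s" by (simp add: F_def)
      then show "h \<in> PiE I (\<lambda>_. {..<s})" unfolding h(1) by (intro restrict_PiE_iff[THEN iffD2]) simp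
    qed
  qed
  have "finite (PiE I (\<lambda>_. {..<s}))" using \<open>finite I\<close> by (intro finite_PiE) auto
  then have "finite F" using bij bij_betw_finite by blast
  have "(\<Sum>d\<in>F. \<Prod>i\<in>I. g d i) = (\<Sum>h\<in>PiE I (\<lambda>_. {..<s}). \<Prod>i\<in>I. g (ext h) i)"
    using sum.reindex_bij_betw[OF bij, of "\<lambda>d. \<Prod>i\<in>I. g d i"] by simp
  also have "\<dots> = (\<Sum>h\<in>PiE I (\<lambda>_. {..<s}). \<Prod>i\<in>I. amp c i (h i) * cnj (amp c' i (h i)))"
    by (simp add: g_def ext_def)
  also have "\<dots> = (\<Prod>i\<in>I. \<Sum>x<s. amp c i x * cnj (amp c' i x))"
    using \<open>finite I\<close> by (subst prod_sum_PiE) auto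
  finally have "(\<Sum>d\<in>F. \<Prod>i\<in>I. g d i) =
      (\<Prod>i\<in>I. word_inner s r \<delta> (window_code s c (i + a1) r) (window_code s c' (i + a1) r))"
    by (simp add: amp_def word_inner_def)
  moreover have "(\<Sum>d\<in>F. \<Prod>i\<in>I. g d i) = (\<Sum>d\<in>F. U_op N \<delta> d c * cnj (U_op N \<delta> d c'))"
    using U by (intro sum.cong) (auto simp: g_def prod.distrib)
  ultimately have sumF: "(\<Sum>d\<in>F. U_op N \<delta> d c * cnj (U_op N \<delta> d c')) =
      (\<Prod>i\<in>I. word_inner s r \<delta> (window_code s c (i + a1) r) (window_code s c' (i + a1) r))" by simp
  have "((\<lambda>d. U_op N \<delta> d c * cnj (U_op N \<delta> d c')) has_sum 0) (configs s q) \<longleftrightarrow>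
      ((\<lambda>d. U_op N \<delta> d c * cnj (U_op N \<delta> d c')) has_sum 0) F"
    using \<open>F \<subseteq> configs s q\<close> U0 by (intro has_sum_cong_neutral) auto
  also have "\<dots> \<longleftrightarrow> (\<Sum>d\<in>F. U_op N \<delta> d c * cnj (U_op N \<delta> d c')) = 0"
    using has_sum_finite[OF \<open>finite F\<close>, of "\<lambda>d. U_op N \<delta> d c * cnj (U_op N \<delta> d c')"]
    by (auto dest: has_sum_unique)
  also have "\<dots> \<longleftrightarrow> (\<exists>i\<in>I. \<not> nonorth_at c c' (i + a1))"
    using \<open>finite I\<close> by (simp add: sumF nonorth_at_def)
  also have "\<dots> \<longleftrightarrow> (\<exists>i. \<not> nonorth_at c c' (i + a1))"
  proof -
    have "nonorth_at c c' (i + a1)" if "i \<notin> I" for i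
      unfolding nonorth_at_def q_window[OF disjI1[OF refl] that] q_window[OF disjI2[OF refl] that]
      by (rule word_inner_diag)
    then show ?thesis by blast
  qed
  also have "\<dots> \<longleftrightarrow> (\<exists>i. \<not> nonorth_at c c' i)"
    by (metis diff_add_cancel)
  finally show ?thesis .
qed

lemma columns_orthogonal_iff:
  fixes a1 :: int
  assumes "N = map (\<lambda>k. a1 + int k) [0..<r]"
  shows "columns_orthogonal s q N \<delta> \<longleftrightarrow> \<not> (\<exists>a b. pair_reach s r \<delta> a b \<and> bad_pair a b)"
proof -
  have "columns_orthogonal s q N \<delta> \<longleftrightarrow>
      \<not> (\<exists>c c'. is_config s q c \<and> is_config s q c' \<and> c \<noteq> c' \<and> (\<forall>i. nonorth_at c c' i))"
    using columns_inner_product[OF assms] by (auto simp: columns_orthogonal_def configs_def)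
  then show ?thesis using configs_of_bad_pair bad_pair_of_configs by metis
qed

end

text \<open>Increasing integers grow by at least 1 per index. Applied from the first entry to
  \<open>k\<close> and from \<open>k\<close> to the last, with total span
  \<open>length N - 1\<close>, this pins every entry from both sides.\<close>

lemma simple_nbhd_eq_interval:
  assumes "sorted_wrt (<) N" "simple_nbhd N"
  shows "N = map (\<lambda>k. hd N + int k) [0..<length N]"
proof -
  have step: "N ! i + int (j - i) \<le> N ! j" if "i \<le> j" "j < length N" for i j
    using that
  proof (induction j rule: dec_induct)
    case (step j)
    moreover have "N ! j < N ! Suc j" using assms(1) step by (simp add: sorted_wrt_nth_less)
    ultimately show ?case by simp
  qed simp
  have ne: "N \<noteq> []" using assms(2) by (simp add: simple_nbhd_def)
  have "N ! k = hd N + int k" if "k < length N" for k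
  proof -
    have "k \<le> length N - 1" using that by simp
    then show ?thesis using step[of 0 k] step[of k "length N - 1"] that ne assms(2)
    by (simp add: simple_nbhd_def hd_conv_nth last_conv_nth of_nat_diff)
  qed
  then show ?thesis by (intro nth_equalityI) auto
qed

section \<open>A structured language for the machine\<close>

type_synonym store = "(nat \<Rightarrow> int) \<times> (nat \<Rightarrow> real)"

text \<open>The guards are negative, as in the conditional jumps: \<open>UnlI i j c\<close> skips \<open>c\<close>, and \<open>Whl i j c\<close>
  stops, if register \<open>i\<close> is at most register \<open>j\<close>.\<close>

datatype com =
    Blk "instr list"
  | Seq com com
  | UnlI nat nat com
  | UnlR nat nat com
  | Whl nat nat com

fun com_size :: "com \<Rightarrow> nat" where
  "com_size (Blk is) = length is"
| "com_size (Seq c d) = com_size c + com_size d"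
| "com_size (UnlI i j c) = Suc (com_size c)"
| "com_size (UnlR i j c) = Suc (com_size c)"
| "com_size (Whl i j c) = Suc (Suc (com_size c))"

text \<open>Jumps of the machine are absolute, so the code depends on its position \<open>p\<close>.
  Comparing register 0 with itself makes the closing jump of a loop unconditional.\<close>

fun compile :: "com \<Rightarrow> nat \<Rightarrow> instr list" where
  "compile (Blk is) p = is"
| "compile (Seq c d) p = compile c p @ compile d (p + com_size c)"
| "compile (UnlI i j c) p = IfILe i j (p + Suc (com_size c)) # compile c (Suc p)"
| "compile (UnlR i j c) p = IfRLe i j (p + Suc (com_size c)) # compile c (Suc p)"
| "compile (Whl i j c) p =
    IfILe i j (p + Suc (Suc (com_size c))) # compile c (Suc p) @ [IfILe 0 0 p]"

lemma length_compile [simp]: "length (compile c p) = com_size c"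
  by (induction c arbitrary: p) auto

fun effect :: "instr \<Rightarrow> store \<Rightarrow> store" where
  "effect (ISet i k) (f, g) = (f(i := k), g)"
| "effect (IAdd i j k) (f, g) = (f(i := f j + f k), g)"
| "effect (ISub i j k) (f, g) = (f(i := f j - f k), g)"
| "effect (ILoad i j) (f, g) = (f(i := f (nat (f j))), g)"
| "effect (IStore i j) (f, g) = (f(nat (f i) := f j), g)"
| "effect (RSet i k) (f, g) = (f, g(i := of_int k))"
| "effect (RAdd i j k) (f, g) = (f, g(i := g j + g k))"
| "effect (RSub i j k) (f, g) = (f, g(i := g j - g k))"
| "effect (RMul i j k) (f, g) = (f, g(i := g j * g k))"
| "effect (RDiv i j k) (f, g) = (f, g(i := g j / g k))"
| "effect (RLoad i j) (f, g) = (f, g(i := g (nat (f j))))"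
| "effect (RStore i j) (f, g) = (f, g(nat (f i) := g j))"
| "effect _ \<sigma> = \<sigma>"

fun straight :: "instr \<Rightarrow> bool" where
  "straight (IfILe _ _ _) = False"
| "straight (IfRLe _ _ _) = False"
| "straight Halt = False"
| "straight _ = True"

definition mstate_at :: "nat \<Rightarrow> store \<Rightarrow> mstate" where
  "mstate_at p \<sigma> = \<lparr>pc = p, ireg = fst \<sigma>, rreg = snd \<sigma>\<rparr>"

text \<open>Quantifying over all surrounding code lets fragments be analysed in isolation and then
  placed anywhere. A run ends exactly behind the fragment, where its successor begins.\<close>

definition runs :: "com \<Rightarrow> store \<Rightarrow> nat \<Rightarrow> store \<Rightarrow> bool" where
  "runs c \<sigma> t \<sigma>' \<longleftrightarrow> (\<forall>pre post.
     (step (pre @ compile c (length pre) @ post) ^^ t) (mstate_at (length pre) \<sigma>)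
       = mstate_at (length pre + com_size c) \<sigma>')"

lemma funpow_addI: "(f ^^ a) x = y \<Longrightarrow> (f ^^ b) y = z \<Longrightarrow> (f ^^ (a + b)) x = z"
  by (simp add: funpow_add add.commute[of a])

lemma step_straight:
  "straight i \<Longrightarrow> step (pre @ i # post) (mstate_at (length pre) \<sigma>) = mstate_at (Suc (length pre)) (effect i \<sigma>)"
  by (cases \<sigma>; cases i) (auto simp: step_def halted_def mstate_at_def)

lemma runs_Blk:
  assumes "list_all straight is"
  shows "runs (Blk is) \<sigma> (length is) (fold effect is \<sigma>)"
proof -
  have "(step (pre @ is @ post) ^^ length is) (mstate_at (length pre) \<sigma>)
      = mstate_at (length pre + length is) (fold effect is \<sigma>)" for pre post
    using assms
  proof (induction "is" arbitrary: pre \<sigma>)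
    case (Cons i "is")
    have "(step (pre @ (i # is) @ post) ^^ (1 + length is)) (mstate_at (length pre) \<sigma>)
      = mstate_at (length (pre @ [i]) + length is) (fold effect is (effect i \<sigma>))"
      using Cons.IH[of "pre @ [i]" "effect i \<sigma>"] Cons.prems
      by (intro funpow_addI[where y = "mstate_at (length (pre @ [i])) (effect i \<sigma>)"]) (auto simp: step_straight)
    then show ?case by simp
  qed simp
  then show ?thesis by (simp add: runs_def)
qed

lemma runs_Seq:
  assumes "runs c \<sigma> t \<sigma>'" "runs d \<sigma>' u \<sigma>''"
  shows "runs (Seq c d) \<sigma> (t + u) \<sigma>''"
  unfolding runs_def
proof (intro allI)
  fix pre post :: "instr list"
  let ?c = "compile c (length pre)" and ?d = "compile d (length pre + com_size c)"
  have "(step (pre @ ?c @ ?d @ post) ^^ t) (mstate_at (length pre) \<sigma>) = mstate_at (length pre + com_size c) \<sigma>'"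
    using assms(1) by (simp add: runs_def)
  moreover have "(step ((pre @ ?c) @ ?d @ post) ^^ u) (mstate_at (length pre + com_size c) \<sigma>')
      = mstate_at (length pre + com_size c + com_size d) \<sigma>''"
    using assms(2)[unfolded runs_def, rule_format, of "pre @ ?c" post] by simp
  ultimately show "(step (pre @ compile (Seq c d) (length pre) @ post) ^^ (t + u)) (mstate_at (length pre) \<sigma>)
      = mstate_at (length pre + com_size (Seq c d)) \<sigma>''"
    by (auto intro: funpow_addI simp: add.assoc)
qed

lemma step_IfILe:
  "step (pre @ IfILe i j t # post) (mstate_at (length pre) \<sigma>)
    = mstate_at (if fst \<sigma> i \<le> fst \<sigma> j then t else Suc (length pre)) \<sigma>"
  by (simp add: step_def halted_def mstate_at_def)

lemma step_IfRLe:
  "step (pre @ IfRLe i j t # post) (mstate_at (length pre) \<sigma>)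
    = mstate_at (if snd \<sigma> i \<le> snd \<sigma> j then t else Suc (length pre)) \<sigma>"
  by (simp add: step_def halted_def mstate_at_def)

lemma runs_UnlI_skip: "fst \<sigma> i \<le> fst \<sigma> j \<Longrightarrow> runs (UnlI i j c) \<sigma> 1 \<sigma>"
  by (simp add: runs_def step_IfILe)

lemma runs_UnlR_skip: "snd \<sigma> i \<le> snd \<sigma> j \<Longrightarrow> runs (UnlR i j c) \<sigma> 1 \<sigma>"
  by (simp add: runs_def step_IfRLe)

lemma runs_Whl_exit: "fst \<sigma> i \<le> fst \<sigma> j \<Longrightarrow> runs (Whl i j c) \<sigma> 1 \<sigma>"
  by (simp add: runs_def step_IfILe)

lemma runs_shifted:
  "runs c \<sigma> t \<sigma>' \<Longrightarrow> (step (pre @ i # compile c (Suc (length pre)) @ post) ^^ t) (mstate_at (Suc (length pre)) \<sigma>)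
    = mstate_at (Suc (length pre) + com_size c) \<sigma>'"
  unfolding runs_def by (drule spec[of _ "pre @ [i]"]) simp

lemma runs_UnlI:
  assumes "\<not> fst \<sigma> i \<le> fst \<sigma> j" "runs c \<sigma> t \<sigma>'"
  shows "runs (UnlI i j c) \<sigma> (1 + t) \<sigma>'"
  unfolding runs_def
proof (intro allI, rule funpow_addI)
  fix pre post :: "instr list"
  show "(step (pre @ compile (UnlI i j c) (length pre) @ post) ^^ 1) (mstate_at (length pre) \<sigma>)
      = mstate_at (Suc (length pre)) \<sigma>"
    using assms(1) by (simp add: step_IfILe)
  show "(step (pre @ compile (UnlI i j c) (length pre) @ post) ^^ t) (mstate_at (Suc (length pre)) \<sigma>)
      = mstate_at (length pre + com_size (UnlI i j c)) \<sigma>'"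
    using runs_shifted[OF assms(2)] by simp
qed

lemma runs_UnlR:
  assumes "\<not> snd \<sigma> i \<le> snd \<sigma> j" "runs c \<sigma> t \<sigma>'"
  shows "runs (UnlR i j c) \<sigma> (1 + t) \<sigma>'"
  unfolding runs_def
proof (intro allI, rule funpow_addI)
  fix pre post :: "instr list"
  show "(step (pre @ compile (UnlR i j c) (length pre) @ post) ^^ 1) (mstate_at (length pre) \<sigma>)
      = mstate_at (Suc (length pre)) \<sigma>"
    using assms(1) by (simp add: step_IfRLe)
  show "(step (pre @ compile (UnlR i j c) (length pre) @ post) ^^ t) (mstate_at (Suc (length pre)) \<sigma>)
      = mstate_at (length pre + com_size (UnlR i j c)) \<sigma>'"
    using runs_shifted[OF assms(2)] by simp
qed

lemma runs_Whl:
  assumes "\<not> fst \<sigma> i \<le> fst \<sigma> j" "runs c \<sigma> t \<sigma>'" "runs (Whl i j c) \<sigma>' u \<sigma>''"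
  shows "runs (Whl i j c) \<sigma> (1 + t + 1 + u) \<sigma>''"
  unfolding runs_def
proof (intro allI)
  fix pre post :: "instr list"
  define P where "P = pre @ compile (Whl i j c) (length pre) @ post"
  have "(step P ^^ 1) (mstate_at (length pre) \<sigma>) = mstate_at (Suc (length pre)) \<sigma>"
    using assms(1) by (simp add: P_def step_IfILe)
  moreover have "(step P ^^ t) (mstate_at (Suc (length pre)) \<sigma>) = mstate_at (Suc (length pre) + com_size c) \<sigma>'"
    using runs_shifted[OF assms(2)] by (simp add: P_def)
  moreover have "(step P ^^ 1) (mstate_at (Suc (length pre) + com_size c) \<sigma>') = mstate_at (length pre) \<sigma>'"
  proof -
    define pre' where "pre' = pre @ IfILe i j (length pre + Suc (Suc (com_size c))) # compile c (Suc (length pre))"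
    have "P = pre' @ IfILe 0 0 (length pre) # post" by (simp add: P_def pre'_def)
    moreover have "length pre' = Suc (length pre) + com_size c" by (simp add: pre'_def)
    ultimately show ?thesis using step_IfILe[of pre' 0 0 "length pre" post \<sigma>'] by simp
  qed
  moreover have "(step P ^^ u) (mstate_at (length pre) \<sigma>') = mstate_at (length pre + com_size (Whl i j c)) \<sigma>''"
    using assms(3) by (simp only: P_def runs_def)
  ultimately show "(step P ^^ (1 + t + 1 + u)) (mstate_at (length pre) \<sigma>) = mstate_at (length pre + com_size (Whl i j c)) \<sigma>''"
    by (blast intro: funpow_addI)
qed

section \<open>Weakest preconditions with a time budget\<close>

definition wp :: "com \<Rightarrow> nat \<Rightarrow> (store \<Rightarrow> bool) \<Rightarrow> store \<Rightarrow> bool" where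
  "wp c T Q \<sigma> \<longleftrightarrow> (\<exists>t\<le>T. \<exists>\<sigma>'. runs c \<sigma> t \<sigma>' \<and> Q \<sigma>')"

lemma wpI: "runs c \<sigma> t \<sigma>' \<Longrightarrow> t \<le> T \<Longrightarrow> Q \<sigma>' \<Longrightarrow> wp c T Q \<sigma>"
  unfolding wp_def by blast

lemma wp_mono: "wp c T Q \<sigma> \<Longrightarrow> T \<le> T' \<Longrightarrow> (\<And>\<sigma>'. Q \<sigma>' \<Longrightarrow> Q' \<sigma>') \<Longrightarrow> wp c T' Q' \<sigma>"
  unfolding wp_def by (meson le_trans)

lemma wp_Blk: "list_all straight is \<Longrightarrow> length is \<le> T \<Longrightarrow> Q (fold effect is \<sigma>) \<Longrightarrow> wp (Blk is) T Q \<sigma>"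
  unfolding wp_def using runs_Blk by blast

lemma wp_Seq: "wp c T (wp d U Q) \<sigma> \<Longrightarrow> T + U \<le> V \<Longrightarrow> wp (Seq c d) V Q \<sigma>"
  unfolding wp_def by (meson runs_Seq add_mono le_trans)

lemma wp_UnlI:
  assumes "fst \<sigma> i \<le> fst \<sigma> j \<Longrightarrow> Q \<sigma>" "\<not> fst \<sigma> i \<le> fst \<sigma> j \<Longrightarrow> wp c T Q \<sigma>" "Suc T \<le> U"
  shows "wp (UnlI i j c) U Q \<sigma>"
proof (cases "fst \<sigma> i \<le> fst \<sigma> j")
  case True
  show ?thesis by (rule wpI[OF runs_UnlI_skip[OF True]]) (use assms True in auto)
next
  case False
  then obtain t \<sigma>' where "t \<le> T" "runs c \<sigma> t \<sigma>'" "Q \<sigma>'" using assms(2) by (auto simp: wp_def)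
  then show ?thesis using wpI[OF runs_UnlI[OF False]] assms(3) by simp
qed

lemma wp_UnlR:
  assumes "snd \<sigma> i \<le> snd \<sigma> j \<Longrightarrow> Q \<sigma>" "\<not> snd \<sigma> i \<le> snd \<sigma> j \<Longrightarrow> wp c T Q \<sigma>" "Suc T \<le> U"
  shows "wp (UnlR i j c) U Q \<sigma>"
proof (cases "snd \<sigma> i \<le> snd \<sigma> j")
  case True
  show ?thesis by (rule wpI[OF runs_UnlR_skip[OF True]]) (use assms True in auto)
next
  case False
  then obtain t \<sigma>' where "t \<le> T" "runs c \<sigma> t \<sigma>'" "Q \<sigma>'" using assms(2) by (auto simp: wp_def)
  then show ?thesis using wpI[OF runs_UnlR[OF False]] assms(3) by simp
qed

text \<open>The index of the invariant is a variant that bounds the remaining iterations. Each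
  iteration pays 2 beyond its body, for the test and the jump back; the last 1 is the final
  test.\<close>

lemma wp_Whl:
  fixes I :: "nat \<Rightarrow> store \<Rightarrow> bool"
  assumes "I n \<sigma>"
    and exit: "\<And>n \<sigma>. I n \<sigma> \<Longrightarrow> fst \<sigma> i \<le> fst \<sigma> j \<Longrightarrow> Q \<sigma>"
    and body: "\<And>n \<sigma>. I n \<sigma> \<Longrightarrow> \<not> fst \<sigma> i \<le> fst \<sigma> j \<Longrightarrow> 0 < n \<and> wp c T (I (n - 1)) \<sigma>"
    and "n * (T + 2) + 1 \<le> U"
  shows "wp (Whl i j c) U Q \<sigma>"
proof -
  have "wp (Whl i j c) (n * (T + 2) + 1) Q \<sigma>"
    using \<open>I n \<sigma>\<close>
  proof (induction n arbitrary: \<sigma>)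
    case 0
    then have "fst \<sigma> i \<le> fst \<sigma> j" using body by blast
    then show ?case using wpI[OF runs_Whl_exit] exit[OF 0] by simp
  next
    case (Suc n)
    show ?case
    proof (cases "fst \<sigma> i \<le> fst \<sigma> j")
      case True
      then show ?thesis using wpI[OF runs_Whl_exit] exit[OF Suc.prems] by simp
    next
      case False
      obtain t \<sigma>' where t: "t \<le> T" "runs c \<sigma> t \<sigma>'" "I n \<sigma>'"
        using body[OF Suc.prems False] by (auto simp: wp_def)
      obtain u \<sigma>'' where u: "u \<le> n * (T + 2) + 1" "runs (Whl i j c) \<sigma>' u \<sigma>''" "Q \<sigma>''"
        using Suc.IH[OF t(3)] by (auto simp: wp_def)
      have "1 + t + 1 + u \<le> Suc n * (T + 2) + 1" using t(1) u(1) by simp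
      then show ?thesis using runs_Whl[OF False t(2) u(2)] u(3) unfolding wp_def by blast
    qed
  qed
  then show ?thesis using wp_mono assms(4) by blast
qed

text \<open>For loops whose number of rounds is known beforehand. Invariants are more natural when
  they count upwards, so the variant is the difference \<open>n - k\<close>.\<close>

lemma wp_count:
  fixes J :: "nat \<Rightarrow> store \<Rightarrow> bool"
  assumes start: "J 0 \<sigma>"
    and test: "\<And>k f g. k \<le> n \<Longrightarrow> J k (f, g) \<Longrightarrow> f i \<le> f j \<longleftrightarrow> k = n"
    and body: "\<And>k f g. k < n \<Longrightarrow> J k (f, g) \<Longrightarrow> wp c T (J (Suc k)) (f, g)"
    and exit: "\<And>f g. J n (f, g) \<Longrightarrow> Q (f, g)"
    and "n * (T + 2) + 1 \<le> U"
  shows "wp (Whl i j c) U Q \<sigma>"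
proof (rule wp_Whl[where I = "\<lambda>m \<sigma>. m \<le> n \<and> J (n - m) \<sigma>" and n = n and T = T])
  show "n \<le> n \<and> J (n - n) \<sigma>" using start by simp
  show "Q \<sigma>" if "m \<le> n \<and> J (n - m) \<sigma>" "fst \<sigma> i \<le> fst \<sigma> j" for m \<sigma>
    using that test[of "n - m"] exit by (cases \<sigma>) auto
  show "0 < m \<and> wp c T (\<lambda>\<sigma>. m - 1 \<le> n \<and> J (n - (m - 1)) \<sigma>) \<sigma>"
    if m: "m \<le> n \<and> J (n - m) \<sigma>" and no: "\<not> fst \<sigma> i \<le> fst \<sigma> j" for m \<sigma>
  proof -
    obtain f g where \<sigma>: "\<sigma> = (f, g)" by fastforce
    have "0 < m" using test[of "n - m" f g] m no by (auto simp: \<sigma>)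
    then have "wp c T (J (Suc (n - m))) \<sigma>" "Suc (n - m) = n - (m - 1)"
      using body[of "n - m" f g] m by (auto simp: \<sigma>)
    then show ?thesis using \<open>0 < m\<close> m by (auto elim!: wp_mono)
  qed
qed fact

lemma wp_SeqI:
  assumes "wp c T R \<sigma>" "\<And>f g. R (f, g) \<Longrightarrow> wp d U Q (f, g)" "T + U \<le> V"
  shows "wp (Seq c d) V Q \<sigma>"
  using wp_Seq[OF wp_mono[OF assms(1) le_refl] assms(3)] assms(2) by (metis surj_pair)

lemma wp_Blk_Seq:
  assumes "list_all straight is" "wp d U Q (fold effect is \<sigma>)" "length is + U \<le> V"
  shows "wp (Seq (Blk is) d) V Q \<sigma>"
  by (rule wp_Seq[OF wp_Blk]) (use assms in auto)

section \<open>The program\<close>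

text \<open>Integer registers: 4 and 5 hold the constants 1 and 0; 6, 7 and 8 hold \<open>L = s ^ r\<close>, \<open>L * L\<close> and
  \<open>2 * s * L\<close>; 9 and 10 are the head and the tail of the queue; 11 is set once a bad pair has been
  found; 12 and 13 hold the pair being visited and 14 the product of its first component with \<open>L\<close>;
  15, 16 and 17 hold the same three numbers after the shift of the window; the other registers
  below 64 are counters and temporaries.\<close>

definition pow_com :: com where
  "pow_com = Seq (Blk [ISet 6 1, IAdd 20 1 5])
     (Whl 20 5 (Seq (Blk [ISet 15 0, IAdd 21 0 5])
       (Seq (Whl 21 5 (Blk [IAdd 15 15 6, ISub 21 21 4])) (Blk [IAdd 6 15 5, ISub 20 20 4]))))"

definition sizes_com :: com where
  "sizes_com = Seq (Blk [IAdd 20 6 5]) (Seq (Whl 20 5 (Blk [IAdd 7 7 6, ISub 20 20 4]))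
     (Seq (Blk [IAdd 20 0 5, IAdd 15 6 6]) (Whl 20 5 (Blk [IAdd 8 8 15, ISub 20 20 4]))))"

text \<open>The table of the local rule occupies the real registers from 0 on, where the temporaries of
  the real arithmetic must live as well, because only integer registers serve as indirect
  addresses. So the table is first moved behind itself, its entry 0 before register 0 becomes
  the temporary of the copying loop.\<close>

definition copy_com :: com where
  "copy_com = Seq (Blk [RStore 8 0, ISet 20 1, IAdd 15 8 4])
     (Whl 8 20 (Blk [RLoad 0 20, RStore 15 0, IAdd 20 20 4, IAdd 15 15 4]))"

text \<open>Register 22 must hold the address of the visited mark of the pair; setting the mark and
  appending the triple happen together.\<close>

definition push_com :: "nat \<Rightarrow> nat \<Rightarrow> nat \<Rightarrow> com" where
  "push_com x y z = Blk [IStore 22 4, IStore 10 x, IAdd 10 10 4, IStore 10 y, IAdd 10 10 4,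
     IStore 10 z, IAdd 10 10 4]"

definition seed_com :: com where
  "seed_com = Seq (Blk [ISet 9 64, IAdd 9 9 7, IAdd 10 9 5, ISet 12 0, ISet 14 0, ISet 22 64])
     (Whl 6 12 (Seq (push_com 12 12 14)
       (Blk [IAdd 12 12 4, IAdd 14 14 6, IAdd 22 22 6, IAdd 22 22 4])))"

definition pop_com :: com where
  "pop_com = Seq (Blk [ILoad 12 9, IAdd 9 9 4, ILoad 13 9, IAdd 9 9 4, ILoad 14 9, IAdd 9 9 4,
       ISet 15 0, ISet 16 0, ISet 17 0, IAdd 20 0 5])
     (Whl 20 5 (Blk [IAdd 15 15 12, IAdd 16 16 13, IAdd 17 17 14, ISub 20 20 4]))"

definition inner_com :: com where
  "inner_com = Seq (Blk [IAdd 18 15 15, IAdd 18 18 8, IAdd 19 16 16, IAdd 19 19 8,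
       RSet 4 0, RSet 5 0, IAdd 20 0 5])
     (Seq (Whl 20 5 (Blk [RLoad 0 18, IAdd 18 18 4, RLoad 1 18, IAdd 18 18 4,
         RLoad 2 19, IAdd 19 19 4, RLoad 3 19, IAdd 19 19 4,
         RMul 6 0 2, RAdd 4 4 6, RMul 6 1 3, RAdd 4 4 6,
         RMul 6 1 2, RAdd 5 5 6, RMul 6 0 3, RSub 5 5 6, ISub 20 20 4]))
       (Blk [RMul 4 4 4, RMul 5 5 5, RAdd 4 4 5, RSet 7 0]))"

section \<open>Powers, sizes and moving the table\<close>

definition same_except :: "nat set \<Rightarrow> (nat \<Rightarrow> int) \<Rightarrow> (nat \<Rightarrow> int) \<Rightarrow> bool" where
  "same_except X f f' \<longleftrightarrow> (\<forall>k. k \<notin> X \<longrightarrow> f' k = f k)"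

lemma wp_pow_com:
  assumes f: "f 0 = int s" "f 1 = int r" "f 4 = 1" "f 5 = 0"
  shows "wp pow_com (r * (4 * s + 7) + 3)
    (\<lambda>(f', g'). g' = g \<and> same_except {6, 15, 20, 21} f f' \<and> f' 6 = int (s ^ r)) (f, g)"
  unfolding pow_com_def
proof (rule wp_Blk_Seq)
  define J where "J k = (\<lambda>(f', g'). g' = g \<and> same_except {6, 15, 20, 21} f f' \<and>
     f' 6 = int (s ^ k) \<and> f' 20 = int r - int k)" for k
  show "wp (Whl 20 5 (Seq (Blk [ISet 15 0, IAdd 21 0 5])
       (Seq (Whl 21 5 (Blk [IAdd 15 15 6, ISub 21 21 4])) (Blk [IAdd 6 15 5, ISub 20 20 4]))))
     (r * (4 * s + 7) + 1)
    (\<lambda>(f', g'). g' = g \<and> same_except {6, 15, 20, 21} f f' \<and> f' 6 = int (s ^ r))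
    (fold effect [ISet 6 1, IAdd 20 1 5] (f, g))"
  proof (rule wp_count[where J = J and n = r and T = "4 * s + 5"])
    fix k f1 g1 assume k: "k < r" and J: "J k (f1, g1)"
    then have f1: "f1 0 = int s" "f1 4 = 1" "f1 5 = 0" using f by (auto simp: J_def same_except_def)
    define K where "K m = (\<lambda>(f', g'). g' = g \<and> same_except {6, 15, 20, 21} f f' \<and>
     f' 6 = int (s ^ k) \<and> f' 20 = int r - int k \<and> f' 15 = int m * int (s ^ k) \<and> f' 21 = int s - int m)" for m
    show "wp (Seq (Blk [ISet 15 0, IAdd 21 0 5])
       (Seq (Whl 21 5 (Blk [IAdd 15 15 6, ISub 21 21 4])) (Blk [IAdd 6 15 5, ISub 20 20 4])))
        (4 * s + 5) (J (Suc k)) (f1, g1)"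
    proof (rule wp_Blk_Seq, simp, rule wp_SeqI)
      show "wp (Whl 21 5 (Blk [IAdd 15 15 6, ISub 21 21 4])) (4 * s + 1) (K s)
         (fold effect [ISet 15 0, IAdd 21 0 5] (f1, g1))"
        by (rule wp_count[where J = K and n = s and T = 2])
          (use J f1 f in \<open>auto simp: K_def J_def same_except_def algebra_simps intro!: wp_Blk\<close>)
      show "wp (Blk [IAdd 6 15 5, ISub 20 20 4]) 2 (J (Suc k)) (f2, g2)" if "K s (f2, g2)" for f2 g2
        by (rule wp_Blk) (use that f in \<open>auto simp: K_def J_def same_except_def\<close>)
    qed auto
  qed (use f in \<open>auto simp: J_def same_except_def\<close>)
qed auto

lemma wp_sizes_com:
  assumes f: "f 0 = int s" "f 6 = int L" "f 7 = 0" "f 8 = 0" "f 4 = 1" "f 5 = 0"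
  shows "wp sizes_com (4 * L + 4 * s + 5)
    (\<lambda>(f', g'). g' = g \<and> same_except {7, 8, 15, 20} f f' \<and> f' 7 = int (L * L) \<and> f' 8 = int (2 * s * L)) (f, g)"
  unfolding sizes_com_def
proof (rule wp_Blk_Seq, simp, rule wp_SeqI)
  define J where "J k = (\<lambda>(f', g'). g' = g \<and> same_except {7, 15, 20} f f' \<and>
     f' 7 = int (k * L) \<and> f' 20 = int L - int k)" for k
  show "wp (Whl 20 5 (Blk [IAdd 7 7 6, ISub 20 20 4])) (4 * L + 1) (J L) (fold effect [IAdd 20 6 5] (f, g))"
    by (rule wp_count[where J = J and n = L and T = 2])
      (use f in \<open>auto simp: J_def same_except_def algebra_simps intro!: wp_Blk\<close>)
  show "wp (Seq (Blk [IAdd 20 0 5, IAdd 15 6 6]) (Whl 20 5 (Blk [IAdd 8 8 15, ISub 20 20 4]))) (4 * s + 3)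
    (\<lambda>(f', g'). g' = g \<and> same_except {7, 8, 15, 20} f f' \<and> f' 7 = int (L * L) \<and> f' 8 = int (2 * s * L)) (f1, g1)"
    if "J L (f1, g1)" for f1 g1
  proof (rule wp_Blk_Seq)
    define K where "K k = (\<lambda>(f', g'). g' = g \<and> same_except {7, 8, 15, 20} f f' \<and> f' 7 = int (L * L) \<and>
      f' 15 = int (2 * L) \<and> f' 8 = int (2 * k * L) \<and> f' 20 = int s - int k)" for k
    show "wp (Whl 20 5 (Blk [IAdd 8 8 15, ISub 20 20 4])) (4 * s + 1)
    (\<lambda>(f', g'). g' = g \<and> same_except {7, 8, 15, 20} f f' \<and> f' 7 = int (L * L) \<and> f' 8 = int (2 * s * L))
     (fold effect [IAdd 20 0 5, IAdd 15 6 6] (f1, g1))"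
      by (rule wp_count[where J = K and n = s and T = 2])
        (use f that in \<open>auto simp: J_def K_def same_except_def algebra_simps intro!: wp_Blk\<close>)
  qed auto
qed auto

lemma wp_copy_com:
  assumes f: "f 8 = int B" "f 4 = 1" and "0 < B"
  shows "wp copy_com (6 * B + 4)
    (\<lambda>(f', g'). same_except {15, 20} f f' \<and> (\<forall>j<B. g' (B + j) = g j)) (f, g)"
  unfolding copy_com_def
proof (rule wp_Blk_Seq)
  \<comment> \<open>Register 0 is the temporary of the loop and thus excluded from the unchanged
    sources. Its entry was moved before the loop, so after \<open>k\<close> rounds
    \<open>Suc k\<close> entries are in place and \<open>B - 1\<close> rounds suffice.\<close>
  define J where "J k = (\<lambda>(f', g'). same_except {15, 20} f f' \<and> (\<forall>j<B. 0 < j \<longrightarrow> g' j = g j) \<and>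
     (\<forall>j<Suc k. g' (B + j) = g j) \<and> f' 20 = int (Suc k) \<and> f' 15 = int (B + Suc k))" for k
  show "wp (Whl 8 20 (Blk [RLoad 0 20, RStore 15 0, IAdd 20 20 4, IAdd 15 15 4])) (6 * B + 1)
     (\<lambda>(f', g'). same_except {15, 20} f f' \<and> (\<forall>j<B. g' (B + j) = g j))
     (fold effect [RStore 8 0, ISet 20 1, IAdd 15 8 4] (f, g))"
  proof (rule wp_count[where J = J and n = "B - 1" and T = 4])
    show "wp (Blk [RLoad 0 20, RStore 15 0, IAdd 20 20 4, IAdd 15 15 4]) 4 (J (Suc k)) (f1, g1)"
      if k: "k < B - 1" and J: "J k (f1, g1)" for k f1 g1
    proof (rule wp_Blk)
      have "g1 (Suc k) = g (Suc k)" using J k by (auto simp: J_def)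
      moreover have "nat (f1 20) = Suc k" "nat (f1 15) = B + Suc k" using J by (auto simp: J_def)
      ultimately show "J (Suc k) (fold effect [RLoad 0 20, RStore 15 0, IAdd 20 20 4, IAdd 15 15 4] (f1, g1))"
        using J f k by (auto simp: J_def same_except_def less_Suc_eq)
    qed auto
  qed (use f \<open>0 < B\<close> in \<open>auto simp: J_def same_except_def algebra_simps\<close>)
qed auto

definition mod_com :: com where
  "mod_com = Seq (Blk [ISub 25 6 4])
     (Seq (Whl 15 25 (Blk [ISub 15 15 6, ISub 17 17 7])) (Whl 16 25 (Blk [ISub 16 16 6])))"

text \<open>Only \<le> can be tested. Two integers are equal iff both differences exceed
  \<open>-1\<close>, and different iff one of them is not at most the other, whence the two attempts
  to set the flag.\<close>

definition flag_com :: com where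
  "flag_com = Seq (Blk [ISub 26 15 16, ISub 27 16 15, ISet 28 (-1)])
     (UnlI 26 28 (UnlI 27 28
       (Seq (UnlI 12 13 (Blk [ISet 11 1])) (UnlI 13 12 (Blk [ISet 11 1])))))"

section \<open>Visited marks and the queue in memory\<close>

lemma nat_of_int_add:
  "v = int k \<Longrightarrow> nat v = k" "v = int k \<Longrightarrow> nat (v + 1) = k + 1" "v = int k \<Longrightarrow> nat (v + 2) = k + 2"
  by auto

text \<open>With abstract addresses, all questions of aliasing are settled by the inequalities
  between 64, \<open>A\<close> and \<open>Q\<close>: registers lie below the marks, and the mark
  lies below the queue cell being written.\<close>

lemma push_effect:
  assumes f: "f 4 = 1" "f 22 = int A" "f 10 = int Q" and A: "64 \<le> A" "A < Q"
    and xyz: "x < 64" "y < 64" "z < 64" "x \<noteq> 10" "y \<noteq> 10" "z \<noteq> 10"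
  shows "fold effect [IStore 22 4, IStore 10 x, IAdd 10 10 4, IStore 10 y, IAdd 10 10 4,
     IStore 10 z, IAdd 10 10 4] (f, g) =
     (f(A := 1, Q := f x, 10 := int Q + 1, Q + 1 := f y, 10 := int Q + 2, Q + 2 := f z, 10 := int Q + 3), g)"
proof -
  have [simp]: "nat (f 22) = A" "nat (f 10) = Q" "nat (int Q + 1) = Q + 1" "nat (2 + int Q) = Q + 2"
    "nat (int Q + 2) = Q + 2"
    using f by auto
  have [simp]: "A \<noteq> k" "Q \<noteq> k" "Q + 1 \<noteq> k" "Q + 2 \<noteq> k" "k \<noteq> A" "k \<noteq> Q" "k \<noteq> Q + 1" "k \<noteq> Q + 2"
    if "k < 64" for k using A that by auto
  show ?thesis using xyz f(1,3) by (simp add: add.commute[of 2 "int Q"] add.commute[of 3 "int Q"] del: add_2_eq_Suc' add_Suc_right One_nat_def)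
qed

text \<open>Two letters give \<open>r \<le> L\<close>, needed for the running time, and put the
  moved table at real register 8 or later, clear of the temporaries 0 to 7.\<close>

locale lqca_store = simple_rule +
  assumes two_states: "2 \<le> s"
begin

abbreviation "L \<equiv> s ^ r"
abbreviation "base \<equiv> 2 * s * L"
abbreviation "queue \<equiv> 64 + L * L"

definition const_regs :: "(nat \<Rightarrow> int) \<Rightarrow> bool" where
  "const_regs f \<longleftrightarrow> f 0 = int s \<and> f 4 = 1 \<and> f 5 = 0 \<and> f 6 = int L \<and> f 7 = int (L * L) \<and> f 8 = int base"

text \<open>Cell \<open>64 + a * L + b\<close> marks the pair \<open>(a, b)\<close> as visited, and an entry of the queue
  is a triple \<open>(a, b, a * L)\<close>, since the machine has no integer multiplication.\<close>

definition mem :: "(nat \<times> nat) list \<Rightarrow> (nat \<Rightarrow> int) \<Rightarrow> bool" where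
  "mem qs f \<longleftrightarrow>
     (\<forall>a<L. \<forall>b<L. f (64 + a * L + b) = (if (a, b) \<in> set qs then 1 else 0)) \<and>
     (\<forall>j<length qs. f (queue + 3 * j) = int (fst (qs ! j)) \<and> f (queue + 3 * j + 1) = int (snd (qs ! j)) \<and>
        f (queue + 3 * j + 2) = int (fst (qs ! j) * L))"

definition table :: "(nat \<Rightarrow> real) \<Rightarrow> bool" where
  "table g \<longleftrightarrow> (\<forall>a<L. \<forall>x<s. g (base + 2 * (a * s + x)) = Re (\<delta> (digits s r a) x) \<and>
     g (base + 2 * (a * s + x) + 1) = Im (\<delta> (digits s r a) x))"

lemma s_le_L: "s \<le> L"
  using r s_pos by (cases r) auto

lemma r_le_L: "r \<le> L"
proof -
  have "r \<le> 2 ^ r" using less_exp[of r] by simp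
  also have "\<dots> \<le> L" using two_states by (intro power_mono) auto
  finally show ?thesis .
qed

lemma base_ge_8: "8 \<le> base"
  using mult_mono[of 2 s 2 L] two_states s_le_L by simp

lemma mem_same:
  assumes "mem qs f" "\<And>k. 64 \<le> k \<Longrightarrow> f' k = f k"
  shows "mem qs f'"
  using assms by (simp add: mem_def)

lemma table_same:
  assumes "table g" "\<And>k. 8 \<le> k \<Longrightarrow> g' k = g k"
  shows "table g'"
  using assms base_ge_8 by (simp add: table_def)

lemma visited_index_less: "a < L \<Longrightarrow> b < L \<Longrightarrow> a * L + b < L * L"
proof -
  assume "a < L" "b < L"
  then have "a * L + b < a * L + L" by simp
  also have "\<dots> = Suc a * L" by simp
  also have "\<dots> \<le> L * L" using \<open>a < L\<close> by (intro mult_le_mono1) simp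
  finally show ?thesis .
qed

lemma visited_index_inj:
  assumes "b < L" "b' < L" "a * L + b = a' * L + b'"
  shows "a = a' \<and> b = b'"
proof -
  have "(a * L + b) div L = a" "(a' * L + b') div L = a'" using assms(1,2) s_pos by (simp_all add: div_mult_self3)
  then have "a = a'" using assms(3) by metis
  then show ?thesis using assms(3) by simp
qed

text \<open>Marks occupy the cells from 64 up to the queue, one per pair by uniqueness of division
  with remainder. So setting one mark disturbs neither another mark nor an older queue
  entry.\<close>

lemma mem_push:
  assumes m: "mem qs f" and ab: "a < L" "b < L"
    and new: "f' (64 + a * L + b) = 1" "f' (queue + 3 * length qs) = int a"
      "f' (queue + 3 * length qs + 1) = int b" "f' (queue + 3 * length qs + 2) = int (a * L)"
    and old: "\<And>k. 64 \<le> k \<Longrightarrow> k < queue + 3 * length qs \<Longrightarrow> k \<noteq> 64 + a * L + b \<Longrightarrow> f' k = f k"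
  shows "mem (qs @ [(a, b)]) f'"
  unfolding mem_def
proof (intro conjI allI impI)
  fix a' b' assume ab': "a' < L" "b' < L"
  have "f' (64 + a' * L + b') = f (64 + a' * L + b')" if "(a', b') \<noteq> (a, b)"
    using visited_index_inj[of b' b a' a] that ab ab' visited_index_less[of a' b'] by (intro old) auto
  then show "f' (64 + a' * L + b') = (if (a', b') \<in> set (qs @ [(a, b)]) then 1 else 0)"
    using m ab' new(1) by (cases "(a', b') = (a, b)") (auto simp: mem_def)
next
  fix j assume "j < length (qs @ [(a, b)])"
  then consider "j < length qs" | "j = length qs" by fastforce
  then have "f' (queue + 3 * j) = int (fst ((qs @ [(a, b)]) ! j)) \<and>
    f' (queue + 3 * j + 1) = int (snd ((qs @ [(a, b)]) ! j)) \<and>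
    f' (queue + 3 * j + 2) = int (fst ((qs @ [(a, b)]) ! j) * L)"
  proof cases
    case 1
    have "f' k = f k" if "queue \<le> k" "k < queue + 3 * length qs" for k
      using that visited_index_less[OF ab] by (intro old) auto
    then show ?thesis using 1 m by (simp add: mem_def nth_append)
  next
    case 2
    then show ?thesis using new by simp
  qed
  then show "f' (queue + 3 * j) = int (fst ((qs @ [(a, b)]) ! j))"
    "f' (queue + 3 * j + 1) = int (snd ((qs @ [(a, b)]) ! j))"
    "f' (queue + 3 * j + 2) = int (fst ((qs @ [(a, b)]) ! j) * L)" by auto
qed

lemma wp_push_com:
  assumes m: "mem qs f" and ab: "a < L" "b < L"
    and f: "f 4 = 1" "f 22 = int (64 + a * L + b)" "f 10 = int (queue + 3 * length qs)"
      "f x = int a" "f y = int b" "f z = int (a * L)"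
    and xyz: "x < 64" "y < 64" "z < 64" "x \<noteq> 10" "y \<noteq> 10" "z \<noteq> 10"
  shows "wp (push_com x y z) 7 (\<lambda>(f', g'). g' = g \<and> mem (qs @ [(a, b)]) f' \<and>
     f' 10 = int (queue + 3 * length (qs @ [(a, b)])) \<and> (\<forall>k<64. k \<noteq> 10 \<longrightarrow> f' k = f k)) (f, g)"
  unfolding push_com_def
proof (rule wp_Blk)
  let ?A = "64 + a * L + b" and ?Q = "queue + 3 * length qs"
  define f' where "f' = f(?A := 1, ?Q := f x, 10 := int ?Q + 1, ?Q + 1 := f y, 10 := int ?Q + 2,
     ?Q + 2 := f z, 10 := int ?Q + 3)"
  have A: "64 \<le> ?A" "?A < ?Q" using visited_index_less[OF ab] by simp_all
  have eq: "fold effect [IStore 22 4, IStore 10 x, IAdd 10 10 4, IStore 10 y, IAdd 10 10 4,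
     IStore 10 z, IAdd 10 10 4] (f, g) = (f', g)"
    unfolding f'_def by (rule push_effect[OF f(1-3) A xyz])
  have "mem (qs @ [(a, b)]) f'"
  proof -
    have g: "f' A = 1 \<and> f' Q = f x \<and> f' (Q + 1) = f y \<and> f' (Q + 2) = f z \<and>
        (\<forall>k. 64 \<le> k \<longrightarrow> k < Q \<longrightarrow> k \<noteq> A \<longrightarrow> f' k = f k)"
      if "64 \<le> A" "A < Q" "f' = f(A := 1, Q := f x, 10 := int Q + 1, Q + 1 := f y, 10 := int Q + 2,
        Q + 2 := f z, 10 := int Q + 3)" for A Q
      using that(1,2) by (simp add: that(3))
    show ?thesis
    proof (rule mem_push[OF m ab])
      show "f' ?A = 1" "f' ?Q = int a" "f' (?Q + 1) = int b" "f' (?Q + 2) = int (a * L)"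
        using g[OF A f'_def] unfolding f(4-6) by blast+
      show "f' k = f k" if "64 \<le> k" "k < ?Q" "k \<noteq> ?A" for k
        using g[OF A f'_def] that by blast
    qed
  qed
  moreover have "f' k = f k" if "k < 64" "k \<noteq> 10" for k using that by (simp add: f'_def)
  moreover have "f' 10 = int (queue + 3 * length (qs @ [(a, b)]))" by (simp add: f'_def)
  ultimately show "case fold effect [IStore 22 4, IStore 10 x, IAdd 10 10 4, IStore 10 y, IAdd 10 10 4,
     IStore 10 z, IAdd 10 10 4] (f, g) of (f', g') \<Rightarrow> g' = g \<and> mem (qs @ [(a, b)]) f' \<and>
     f' 10 = int (queue + 3 * length (qs @ [(a, b)])) \<and> (\<forall>k<64. k \<noteq> 10 \<longrightarrow> f' k = f k)"
    unfolding eq prod.case by blast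
qed auto

lemma wp_seed_com:
  assumes c: "const_regs f" and m: "mem [] f"
  shows "wp seed_com (13 * L + 7)
    (\<lambda>(f', g'). g' = g \<and> const_regs f' \<and> f' 9 = int queue \<and> f' 10 = int (queue + 3 * L) \<and> f' 11 = f 11 \<and>
      mem (map (\<lambda>a. (a, a)) [0..<L]) f') (f, g)"
  unfolding seed_com_def
proof (rule wp_Blk_Seq)
  let ?qs = "\<lambda>k. map (\<lambda>a. (a, a)) [0..<k]"
  define J where "J k = (\<lambda>(f', g'). g' = g \<and> const_regs f' \<and> f' 9 = int queue \<and> f' 10 = int (queue + 3 * k) \<and>
    f' 11 = f 11 \<and> f' 12 = int k \<and> f' 14 = int (k * L) \<and> f' 22 = int (64 + k * L + k) \<and> mem (?qs k) f')" for k
  show "wp (Whl 6 12 (Seq (push_com 12 12 14) (Blk [IAdd 12 12 4, IAdd 14 14 6, IAdd 22 22 6, IAdd 22 22 4])))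
      (13 * L + 1)
      (\<lambda>(f', g'). g' = g \<and> const_regs f' \<and> f' 9 = int queue \<and> f' 10 = int (queue + 3 * L) \<and> f' 11 = f 11 \<and>
      mem (?qs L) f')
      (fold effect [ISet 9 64, IAdd 9 9 7, IAdd 10 9 5, ISet 12 0, ISet 14 0, ISet 22 64] (f, g))"
  proof (rule wp_count[where J = J and n = L and T = 11])
    show "J 0 (fold effect [ISet 9 64, IAdd 9 9 7, IAdd 10 9 5, ISet 12 0, ISet 14 0, ISet 22 64] (f, g))"
      using c by (auto simp: J_def const_regs_def intro!: mem_same[OF m])
    show "wp (Seq (push_com 12 12 14) (Blk [IAdd 12 12 4, IAdd 14 14 6, IAdd 22 22 6, IAdd 22 22 4]))
      11 (J (Suc k)) (f1, g1)" if k: "k < L" and J: "J k (f1, g1)" for k f1 g1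
    proof (rule wp_SeqI)
      show "wp (push_com 12 12 14) 7 (\<lambda>(f', g'). g' = g1 \<and> mem (?qs k @ [(k, k)]) f' \<and>
         f' 10 = int (queue + 3 * length (?qs k @ [(k, k)])) \<and> (\<forall>k<64. k \<noteq> 10 \<longrightarrow> f' k = f1 k)) (f1, g1)"
        using J k by (intro wp_push_com) (auto simp: J_def const_regs_def)
      show "wp (Blk [IAdd 12 12 4, IAdd 14 14 6, IAdd 22 22 6, IAdd 22 22 4]) 4 (J (Suc k)) (f2, g2)"
        if "case (f2, g2) of (f', g') \<Rightarrow> g' = g1 \<and> mem (?qs k @ [(k, k)]) f' \<and>
         f' 10 = int (queue + 3 * length (?qs k @ [(k, k)])) \<and> (\<forall>k<64. k \<noteq> 10 \<longrightarrow> f' k = f1 k)" for f2 g2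
        by (rule wp_Blk) (use that J in \<open>auto simp: J_def const_regs_def algebra_simps elim!: mem_same\<close>)
    qed auto
  qed (use c in \<open>auto simp: J_def const_regs_def\<close>)
qed auto

lemma wp_pop_com:
  assumes c: "const_regs f" and m: "mem qs f" and h: "h < length qs" "qs ! h = (a, b)"
    and f: "f 9 = int (queue + 3 * h)"
  shows "wp pop_com (6 * s + 11)
    (\<lambda>(f', g'). g' = g \<and> const_regs f' \<and> mem qs f' \<and> f' 9 = int (queue + 3 * Suc h) \<and> f' 10 = f 10 \<and> f' 11 = f 11 \<and>
      f' 12 = int a \<and> f' 13 = int b \<and> f' 15 = int (a * s) \<and> f' 16 = int (b * s) \<and> f' 17 = int (a * s * L)) (f, g)"
  unfolding pop_com_def
proof (rule wp_Blk_Seq)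
  let ?pop = "[ILoad 12 9, IAdd 9 9 4, ILoad 13 9, IAdd 9 9 4, ILoad 14 9, IAdd 9 9 4,
       ISet 15 0, ISet 16 0, ISet 17 0, IAdd 20 0 5]"
  define J where "J k = (\<lambda>(f', g'). g' = g \<and> const_regs f' \<and> mem qs f' \<and> f' 9 = int (queue + 3 * Suc h) \<and> f' 10 = f 10 \<and>
      f' 11 = f 11 \<and> f' 12 = int a \<and> f' 13 = int b \<and> f' 14 = int (a * L) \<and> f' 15 = int (a * k) \<and>
      f' 16 = int (b * k) \<and> f' 17 = int (a * k * L) \<and> f' 20 = int s - int k)" for k
  have n: "nat (f 9) = queue + 3 * h" "nat (f 9 + 1) = queue + 3 * h + 1" "nat (f 9 + 2) = queue + 3 * h + 2"
    by (fact nat_of_int_add[OF f])+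
  have q: "f (queue + 3 * h) = int a" "f (queue + 3 * h + 1) = int b" "f (queue + 3 * h + 2) = int (a * L)"
    using m h by (auto simp: mem_def)
  have "J 0 (fold effect ?pop (f, g))"
    using n q c f by (auto simp: J_def const_regs_def intro!: mem_same[OF m])
  then show "wp (Whl 20 5 (Blk [IAdd 15 15 12, IAdd 16 16 13, IAdd 17 17 14, ISub 20 20 4])) (6 * s + 1)
    (\<lambda>(f', g'). g' = g \<and> const_regs f' \<and> mem qs f' \<and> f' 9 = int (queue + 3 * Suc h) \<and> f' 10 = f 10 \<and> f' 11 = f 11 \<and>
      f' 12 = int a \<and> f' 13 = int b \<and> f' 15 = int (a * s) \<and> f' 16 = int (b * s) \<and> f' 17 = int (a * s * L))
    (fold effect ?pop (f, g))"
    by (rule wp_count[where J = J and n = s and T = 4])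
      (auto simp: J_def const_regs_def algebra_simps intro!: wp_Blk elim!: mem_same)
qed auto

end

section \<open>The orthogonality test and the reduction modulo \<open>s ^ r\<close>\<close>

lemma inner_step:
  assumes A: "nat (f 18) = A" "nat (f 18 + 1) = A + 1" "nat (f 19) = A'" "nat (f 19 + 1) = A' + 1" "f 4 = 1"
    and "8 \<le> A" "8 \<le> A'"
  shows "\<exists>g'. fold effect [RLoad 0 18, IAdd 18 18 4, RLoad 1 18, IAdd 18 18 4,
         RLoad 2 19, IAdd 19 19 4, RLoad 3 19, IAdd 19 19 4,
         RMul 6 0 2, RAdd 4 4 6, RMul 6 1 3, RAdd 4 4 6,
         RMul 6 1 2, RAdd 5 5 6, RMul 6 0 3, RSub 5 5 6, ISub 20 20 4] (f, g) =
       (f(18 := f 18 + 2, 19 := f 19 + 2, 20 := f 20 - 1), g') \<and>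
     g' 4 = g 4 + g A * g A' + g (A + 1) * g (A' + 1) \<and>
     g' 5 = g 5 + g (A + 1) * g A' - g A * g (A' + 1) \<and> (\<forall>k\<ge>8. g' k = g k)"
proof -
  have [simp]: "A \<noteq> k" "A' \<noteq> k" "A + 1 \<noteq> k" "A' + 1 \<noteq> k" "Suc A \<noteq> k" "Suc A' \<noteq> k" if "k < 8" for k
    using assms(6,7) that by auto
  show ?thesis
    by (intro exI[of _ "g(0 := g A, 1 := g (A + 1), 2 := g A', 3 := g (A' + 1),
        4 := g 4 + g A * g A' + g (A + 1) * g (A' + 1),
        5 := g 5 + g (A + 1) * g A' - g A * g (A' + 1), 6 := g A * g (A' + 1))"] conjI)
      (simp_all add: A fun_eq_iff)
qed

context lqca_store
begin

lemma word_inner_parts: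
  "Re (\<delta> v x * cnj (\<delta> w x)) = Re (\<delta> v x) * Re (\<delta> w x) + Im (\<delta> v x) * Im (\<delta> w x)"
  "Im (\<delta> v x * cnj (\<delta> w x)) = Im (\<delta> v x) * Re (\<delta> w x) - Re (\<delta> v x) * Im (\<delta> w x)"
  by simp_all

lemma wp_inner_com:
  assumes c: "const_regs f" and t: "table g" and ab: "a < L" "b < L"
    and f: "f 15 = int (a * s)" "f 16 = int (b * s)"
  shows "wp inner_com (19 * s + 12)
    (\<lambda>(f', g'). same_except {18, 19, 20} f f' \<and> table g' \<and>
      (g' 4 \<le> g' 7 \<longleftrightarrow> word_inner s r \<delta> a b = 0)) (f, g)"
  unfolding inner_com_def
proof (rule wp_Blk_Seq, simp, rule wp_SeqI)
  let ?u = "\<lambda>x. \<delta> (digits s r a) x * cnj (\<delta> (digits s r b) x)"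
  define J where "J k = (\<lambda>(f', g'). same_except {18, 19, 20} f f' \<and> table g' \<and>
     f' 18 = int (base + 2 * (a * s + k)) \<and> f' 19 = int (base + 2 * (b * s + k)) \<and> f' 20 = int s - int k \<and>
     g' 4 = (\<Sum>x<k. Re (?u x)) \<and> g' 5 = (\<Sum>x<k. Im (?u x)))" for k
  let ?is = "[RLoad 0 18, IAdd 18 18 4, RLoad 1 18, IAdd 18 18 4,
         RLoad 2 19, IAdd 19 19 4, RLoad 3 19, IAdd 19 19 4,
         RMul 6 0 2, RAdd 4 4 6, RMul 6 1 3, RAdd 4 4 6,
         RMul 6 1 2, RAdd 5 5 6, RMul 6 0 3, RSub 5 5 6, ISub 20 20 4]"
  show "wp (Whl 20 5 (Blk ?is)) (19 * s + 1) (J s)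
    (fold effect [IAdd 18 15 15, IAdd 18 18 8, IAdd 19 16 16, IAdd 19 19 8,
       RSet 4 0, RSet 5 0, IAdd 20 0 5] (f, g))"
  proof (rule wp_count[where J = J and n = s and T = 17])
    show "J 0 (fold effect [IAdd 18 15 15, IAdd 18 18 8, IAdd 19 16 16, IAdd 19 19 8,
       RSet 4 0, RSet 5 0, IAdd 20 0 5] (f, g))"
      using c f by (auto simp: J_def const_regs_def same_except_def intro!: table_same[OF t])
    show "f1 20 \<le> f1 5 \<longleftrightarrow> k = s" if "k \<le> s" "J k (f1, g1)" for k f1 g1
      using that c by (auto simp: J_def const_regs_def same_except_def)
    show "wp (Blk ?is) 17 (J (Suc k)) (f1, g1)" if k: "k < s" and J: "J k (f1, g1)" for k f1 g1
    proof (rule wp_Blk)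
      let ?A = "base + 2 * (a * s + k)" and ?A' = "base + 2 * (b * s + k)"
      have f1: "f1 18 = int ?A" "f1 19 = int ?A'" "f1 4 = 1"
        using J c by (auto simp: J_def const_regs_def same_except_def)
      have "8 \<le> ?A" "8 \<le> ?A'" using base_ge_8 by linarith+
      with inner_step[of f1 ?A ?A' g1] nat_of_int_add[OF f1(1)] nat_of_int_add[OF f1(2)] f1(3)
      obtain g2 where e: "fold effect ?is (f1, g1) =
          (f1(18 := f1 18 + 2, 19 := f1 19 + 2, 20 := f1 20 - 1), g2)"
        and g2: "g2 4 = g1 4 + g1 ?A * g1 ?A' + g1 (?A + 1) * g1 (?A' + 1)"
          "g2 5 = g1 5 + g1 (?A + 1) * g1 ?A' - g1 ?A * g1 (?A' + 1)" "\<And>k. 8 \<le> k \<Longrightarrow> g2 k = g1 k"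
        by blast
      have t1: "table g1" using J by (simp add: J_def)
      then have "g1 ?A = Re (\<delta> (digits s r a) k)" "g1 (?A + 1) = Im (\<delta> (digits s r a) k)"
         "g1 ?A' = Re (\<delta> (digits s r b) k)" "g1 (?A' + 1) = Im (\<delta> (digits s r b) k)"
        using ab k unfolding table_def by blast+
      moreover have "g1 4 = (\<Sum>x<k. Re (?u x))" "g1 5 = (\<Sum>x<k. Im (?u x))"
        using J by (simp_all add: J_def)
      ultimately have "g2 4 = (\<Sum>x<Suc k. Re (?u x))" "g2 5 = (\<Sum>x<Suc k. Im (?u x))"
        unfolding g2(1,2) sum.lessThan_Suc word_inner_parts by simp_all
      moreover have "table g2" by (rule table_same[OF t1 g2(3)])
      ultimately show "J (Suc k) (fold effect ?is (f1, g1))"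
        using J unfolding e by (auto simp: J_def same_except_def)
    qed auto
  qed auto
  show "wp (Blk [RMul 4 4 4, RMul 5 5 5, RAdd 4 4 5, RSet 7 0]) 4
    (\<lambda>(f', g'). same_except {18, 19, 20} f f' \<and> table g' \<and>
      (g' 4 \<le> g' 7 \<longleftrightarrow> word_inner s r \<delta> a b = 0)) (f1, g1)" if J: "J s (f1, g1)" for f1 g1
  proof (rule wp_Blk)
    have "g1 4 = Re (word_inner s r \<delta> a b)" "g1 5 = Im (word_inner s r \<delta> a b)"
      using J unfolding word_inner_def Re_sum Im_sum by (simp_all add: J_def)
    \<comment> \<open>A squared modulus is never negative, so a single real comparison with 0
      decides whether a complex number vanishes.\<close>
    then have "g1 4 * g1 4 + g1 5 * g1 5 \<le> 0 \<longleftrightarrow> word_inner s r \<delta> a b = 0"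
      by (simp add: complex_eq_iff sum_squares_le_zero_iff)
    moreover have "table (g1(4 := x, 5 := y, 7 := z))" for x y z
      using J by (auto simp: J_def elim!: table_same)
    ultimately show "case fold effect [RMul 4 4 4, RMul 5 5 5, RAdd 4 4 5, RSet 7 0] (f1, g1) of
      (f', g') \<Rightarrow> same_except {18, 19, 20} f f' \<and> table g' \<and>
      (g' 4 \<le> g' 7 \<longleftrightarrow> word_inner s r \<delta> a b = 0)"
      using J by (auto simp: J_def elim!: table_same)
  qed auto
qed auto

text \<open>Bounds the number of subtractions in the reduction of \<open>a * s\<close>, keeping it
  linear in \<open>s\<close>.\<close>

lemma mult_div_le: "a < L \<Longrightarrow> a * s div L \<le> s"
  using s_pos by (metis div_le_mono less_imp_le mult.commute mult_le_mono1 nonzero_mult_div_cancel_right power_not_zero less_numeral_extra(3))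

lemma wp_mod_com:
  assumes c: "const_regs f" and ab: "a < L" "b < L"
    and f: "f 15 = int (a * s)" "f 16 = int (b * s)" "f 17 = int (a * s * L)"
  shows "wp mod_com (7 * s + 3)
    (\<lambda>(f', g'). g' = g \<and> same_except {15, 16, 17, 25} f f' \<and> f' 15 = int (a * s mod L) \<and>
      f' 16 = int (b * s mod L) \<and> f' 17 = int ((a * s mod L) * L)) (f, g)"
  unfolding mod_com_def
proof (rule wp_Blk_Seq, simp, rule wp_SeqI)
  define n m where "n = a * s div L" and "m = a * s mod L"
  define n' m' where "n' = b * s div L" and "m' = b * s mod L"
  have m: "m < L" "a * s = n * L + m" and m': "m' < L" "b * s = n' * L + m'"
    using s_pos by (simp_all add: m_def n_def m'_def n'_def div_mult_mod_eq del: mod_mult_mult2)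
  have n: "n \<le> s" "n' \<le> s" using mult_div_le ab by (auto simp: n_def n'_def)
  \<comment> \<open>Register 25 holds \<open>L - 1\<close>, so the guard expresses being less than
    \<open>L\<close>. While a multiple of \<open>L\<close> is left, the value is at least
    \<open>L\<close>.\<close>
  have exit: "int ((n - k) * L + m) \<le> int L - 1 \<longleftrightarrow> k = n" if "k \<le> n" "m < L" for k n m :: nat
  proof (cases "k = n")
    case False
    then have "1 * L \<le> (n - k) * L" using that by (intro mult_le_mono1) simp
    then have "int L \<le> int ((n - k) * L + m)" by linarith
    then show ?thesis using False by linarith
  next
    case True
    then have "(n - k) * L + m = m" by simp
    then show ?thesis using True that by linarith
  qed
  have diff_Suc: "(n - k) * L = (n - Suc k) * L + L" if "k < n" for n k
    using that by (simp add: Suc_diff_Suc flip: mult_Suc add.commute)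
  define J where "J k = (\<lambda>(f', g'). g' = g \<and> same_except {15, 17, 25} f f' \<and> f' 25 = int L - 1 \<and>
    f' 15 = int ((n - k) * L + m) \<and> f' 17 = int (((n - k) * L + m) * L))" for k
  show "wp (Whl 15 25 (Blk [ISub 15 15 6, ISub 17 17 7])) (4 * s + 1) (J n) (fold effect [ISub 25 6 4] (f, g))"
  proof (rule wp_count[where J = J and n = n and T = 2])
    show "J 0 (fold effect [ISub 25 6 4] (f, g))"
      using c f by (auto simp: J_def const_regs_def same_except_def m(2))
    show "f1 15 \<le> f1 25 \<longleftrightarrow> k = n" if "k \<le> n" "J k (f1, g1)" for k f1 g1
      using exit[OF that(1) m(1)] that(2) by (simp add: J_def)
    show "wp (Blk [ISub 15 15 6, ISub 17 17 7]) 2 (J (Suc k)) (f1, g1)" if "k < n" "J k (f1, g1)" for k f1 g1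
    proof (rule wp_Blk)
      define e where "e = (n - Suc k) * L + m"
      have e: "(n - k) * L + m = e + L" using diff_Suc[OF that(1)] by (simp add: e_def)
      have "f1 15 = int e + int L" "f1 17 = int (e * L) + int (L * L)" "f1 25 = int L - 1"
        "g1 = g" "same_except {15, 17, 25} f f1"
        using that(2) unfolding J_def prod.case e add_mult_distrib of_nat_add by blast+
      then show "J (Suc k) (fold effect [ISub 15 15 6, ISub 17 17 7] (f1, g1))"
        using c by (simp add: J_def const_regs_def same_except_def flip: e_def)
    qed auto
  qed (use n in auto)
  define K where "K k = (\<lambda>(f', g'). g' = g \<and> same_except {15, 16, 17, 25} f f' \<and> f' 25 = int L - 1 \<and>
    f' 15 = int m \<and> f' 17 = int (m * L) \<and> f' 16 = int ((n' - k) * L + m'))" for k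
  show "wp (Whl 16 25 (Blk [ISub 16 16 6])) (3 * s + 1)
    (\<lambda>(f', g'). g' = g \<and> same_except {15, 16, 17, 25} f f' \<and> f' 15 = int (a * s mod L) \<and>
      f' 16 = int (b * s mod L) \<and> f' 17 = int ((a * s mod L) * L)) (f1, g1)" if J: "J n (f1, g1)" for f1 g1
  proof (rule wp_count[where J = K and n = n' and T = 1])
    show "K 0 (f1, g1)"
      using J f by (auto simp: J_def K_def same_except_def m'(2))
    show "f1 16 \<le> f1 25 \<longleftrightarrow> k = n'" if "k \<le> n'" "K k (f1, g1)" for k f1 g1
      using exit[OF that(1) m'(1)] that(2) by (simp add: K_def)
    show "wp (Blk [ISub 16 16 6]) 1 (K (Suc k)) (f1, g1)" if "k < n'" "K k (f1, g1)" for k f1 g1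
      by (rule wp_Blk) (use that c diff_Suc[of k n'] in \<open>auto simp: K_def const_regs_def same_except_def\<close>)
  qed (use n in \<open>auto simp: K_def m_def m'_def\<close>)
qed auto

lemma wp_flag_com:
  assumes f: "f 12 = int a" "f 13 = int b" "f 15 = int m" "f 16 = int m'"
  shows "wp flag_com 9
    (\<lambda>(f', g'). g' = g \<and> same_except {11, 26, 27, 28} f f' \<and>
      f' 11 = (if a \<noteq> b \<and> m = m' then 1 else f 11)) (f, g)"
  unfolding flag_com_def
  by (rule wp_Blk_Seq, simp, rule wp_UnlI[where T = 5], use f in \<open>simp add: same_except_def\<close>,
    rule wp_UnlI[where T = 4], use f in \<open>simp add: same_except_def\<close>,
    rule wp_Seq[where T = 2 and U = 2], rule wp_UnlI[where T = 1], rule wp_UnlI[where T = 1])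
   (use f in \<open>auto simp: same_except_def intro!: wp_Blk wp_UnlI[where T = 1]\<close>)

end

section \<open>Successors of a pair and one visit of the search\<close>

definition expand_com :: com where
  "expand_com = Seq (Blk [IAdd 20 0 5])
     (Whl 20 5 (Seq (Blk [IAdd 21 0 5, ISet 22 64, IAdd 22 22 17, IAdd 22 22 16, IAdd 24 16 5])
       (Seq (Whl 21 5 (Seq (Blk [ILoad 23 22])
           (Seq (UnlI 4 23 (push_com 15 24 17)) (Blk [IAdd 22 22 4, IAdd 24 24 4, ISub 21 21 4]))))
         (Blk [IAdd 15 15 4, IAdd 17 17 6, ISub 20 20 4]))))"

definition visit_com :: com where
  "visit_com = Seq pop_com (Seq inner_com (UnlR 4 7 (Seq mod_com (Seq flag_com expand_com))))"

definition main_com :: com where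
  "main_com = Seq pow_com (Seq sizes_com (Seq copy_com (Seq seed_com
     (Seq (Whl 10 9 visit_com) (Blk [ISub 0 4 11])))))"

text \<open>With a single state, register 0 already holds the right answer 1.\<close>

definition program :: "instr list" where
  "program = compile (Seq (Blk [ISet 4 1]) (UnlI 0 4 main_com)) 0"

text \<open>The result of offering every pair of \<open>S\<close> to the queue: all of
  \<open>S\<close> is now present, and whatever was added comes from \<open>S\<close>. As old
  entries form a prefix, their indices stay valid.\<close>

definition extends :: "(nat \<times> nat) list \<Rightarrow> (nat \<times> nat) set \<Rightarrow> (nat \<times> nat) list \<Rightarrow> bool" where
  "extends qs S qs' \<longleftrightarrow> (\<exists>zs. qs' = qs @ zs \<and> set zs \<subseteq> S) \<and> S \<subseteq> set qs' \<and> (distinct qs \<longrightarrow> distinct qs')"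

lemma extends_empty: "extends qs {} qs"
  by (simp add: extends_def)

lemma extends_old: "extends qs S qs' \<Longrightarrow> p \<in> set qs' \<Longrightarrow> extends qs (insert p S) qs'"
  by (auto simp: extends_def)

lemma extends_new: "extends qs S qs' \<Longrightarrow> p \<notin> set qs' \<Longrightarrow> extends qs (insert p S) (qs' @ [p])"
  by (auto simp: extends_def)

text \<open>The progress of two nested loops over the letters: \<open>k\<close> complete rows and
  \<open>m\<close> entries of the next one. All successors are reached at \<open>k = s\<close>,
  \<open>m = 0\<close>.\<close>

definition block :: "nat \<Rightarrow> nat \<Rightarrow> nat \<Rightarrow> nat \<Rightarrow> nat \<Rightarrow> (nat \<times> nat) set" where
  "block s a b k m = {(a + i, b + j) |i j. i < k \<and> j < s \<or> i = k \<and> j < m}"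

lemma block_empty: "block s a b 0 0 = {}"
  by (auto simp: block_def)

lemma block_next_row: "block s a b k s = block s a b (Suc k) 0"
  by (auto simp: block_def less_Suc_eq)

lemma block_next_column: "block s a b k (Suc m) = insert (a + k, b + m) (block s a b k m)"
  by (auto simp: block_def less_Suc_eq)

context lqca_store
begin

text \<open>The residue is a multiple of \<open>s\<close> below \<open>L\<close>, and
  \<open>L\<close> is itself a multiple of \<open>s\<close>; so the residue is at most
  \<open>L - s\<close>, which leaves room for one letter.\<close>

lemma shifted_add_less: "x < s \<Longrightarrow> a * s mod L + x < L"
proof -
  assume x: "x < s"
  obtain k where r': "r = Suc k" using r gr0_implies_Suc by blast
  have "a mod s ^ k + 1 \<le> s ^ k" using s_pos by (simp add: Suc_le_eq)
  then have "(a mod s ^ k + 1) * s \<le> s ^ k * s" by (rule mult_le_mono1)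
  moreover have "a * s mod L = a mod s ^ k * s" unfolding r' power_Suc2 mult_mod_left ..
  moreover have "L = s ^ k * s" unfolding r' power_Suc2 ..
  ultimately show ?thesis using x unfolding add_mult_distrib by linarith
qed

text \<open>The address of the mark and the components of the candidate advance by additions alone,
  so each of the \<open>s * s\<close> candidates costs a constant: 12 for the body of the inner loop
  and 2 for its control.\<close>

lemma wp_expand_com:
  assumes c: "const_regs f" and m: "mem qs f"
    and ab: "\<And>x. x < s \<Longrightarrow> a + x < L" "\<And>x. x < s \<Longrightarrow> b + x < L"
    and f: "f 10 = int (queue + 3 * length qs)" "f 15 = int a" "f 16 = int b" "f 17 = int (a * L)"
  shows "wp expand_com (s * (14 * s + 11) + 2)
    (\<lambda>(f', g'). g' = g \<and> const_regs f' \<and> f' 9 = f 9 \<and> f' 11 = f 11 \<and>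
      (\<exists>qs'. mem qs' f' \<and> f' 10 = int (queue + 3 * length qs') \<and> extends qs (block s a b s 0) qs')) (f, g)"
  unfolding expand_com_def
proof (rule wp_Blk_Seq)
  let ?in = "Seq (Blk [ILoad 23 22])
      (Seq (UnlI 4 23 (push_com 15 24 17)) (Blk [IAdd 22 22 4, IAdd 24 24 4, ISub 21 21 4]))"
  let ?out = "Seq (Blk [IAdd 21 0 5, ISet 22 64, IAdd 22 22 17, IAdd 22 22 16, IAdd 24 16 5])
       (Seq (Whl 21 5 ?in) (Blk [IAdd 15 15 4, IAdd 17 17 6, ISub 20 20 4]))"
  define J where "J k j = (\<lambda>(f', g'). g' = g \<and> const_regs f' \<and> f' 9 = f 9 \<and> f' 11 = f 11 \<and> f' 16 = int b \<and>
    f' 15 = int (a + k) \<and> f' 17 = int ((a + k) * L) \<and> f' 20 = int s - int k \<and>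
    (\<exists>qs'. mem qs' f' \<and> f' 10 = int (queue + 3 * length qs') \<and> extends qs (block s a b k j) qs'))" for k j
  define K where "K k j = (\<lambda>(f', g'). J k j (f', g') \<and> f' 22 = int (64 + (a + k) * L + (b + j)) \<and>
    f' 24 = int (b + j) \<and> f' 21 = int s - int j)" for k j
  have J_same: "J k j (f2, g1)" if "J k j (f1, g1)" "\<And>n. n \<notin> {21, 22, 23, 24} \<Longrightarrow> f2 n = f1 n" for k j f1 f2 g1
  proof -
    have "mem qs' f2" if "mem qs' f1" for qs'
      using that \<open>\<And>n. n \<notin> {21, 22, 23, 24} \<Longrightarrow> f2 n = f1 n\<close> by (elim mem_same) auto
    then show ?thesis using that by (auto simp: J_def const_regs_def)
  qed
  show "wp (Whl 20 5 ?out) (s * (14 * s + 11) + 1)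
    (\<lambda>(f', g'). g' = g \<and> const_regs f' \<and> f' 9 = f 9 \<and> f' 11 = f 11 \<and>
      (\<exists>qs'. mem qs' f' \<and> f' 10 = int (queue + 3 * length qs') \<and> extends qs (block s a b s 0) qs'))
    (fold effect [IAdd 20 0 5] (f, g))"
  proof (rule wp_count[where J = "\<lambda>k. J k 0" and n = s and T = "14 * s + 9"])
    have "mem qs (f(20 := int s))" by (rule mem_same[OF m]) simp
    then show "J 0 0 (fold effect [IAdd 20 0 5] (f, g))"
      using c f extends_empty by (auto simp: J_def const_regs_def block_empty)
    show "f1 20 \<le> f1 5 \<longleftrightarrow> k = s" if "k \<le> s" "J k 0 (f1, g1)" for k f1 g1
      using that by (auto simp: J_def const_regs_def)
    show "wp ?out (14 * s + 9) (J (Suc k) 0) (f1, g1)" if k: "k < s" and J: "J k 0 (f1, g1)" for k f1 g1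
    proof (rule wp_Blk_Seq, simp, rule wp_SeqI)
      show "wp (Whl 21 5 ?in) (14 * s + 1) (K k s)
        (fold effect [IAdd 21 0 5, ISet 22 64, IAdd 22 22 17, IAdd 22 22 16, IAdd 24 16 5] (f1, g1))"
      proof (rule wp_count[where J = "K k" and n = s and T = 12])
        have "f1 0 = int s" "f1 5 = 0" "f1 15 = int (a + k)" "f1 17 = int ((a + k) * L)" "f1 16 = int b"
          using J by (auto simp: J_def const_regs_def)
        moreover have "J k 0 (f1(21 := x, 22 := y, 24 := z), g1)" for x y z
          by (rule J_same[OF J]) simp
        ultimately show "K k 0 (fold effect [IAdd 21 0 5, ISet 22 64, IAdd 22 22 17, IAdd 22 22 16, IAdd 24 16 5] (f1, g1))"
          by (simp add: K_def)
        show "f2 21 \<le> f2 5 \<longleftrightarrow> j = s" if "j \<le> s" "K k j (f2, g2)" for j f2 g2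
          using that by (auto simp: K_def J_def const_regs_def)
        show "wp ?in 12 (K k (Suc j)) (f2, g2)" if j: "j < s" and K: "K k j (f2, g2)" for j f2 g2
        proof (rule wp_Blk_Seq, simp, rule wp_SeqI)
          let ?p = "(a + k, b + j)"
          have p: "a + k < L" "b + j < L" using ab k j by auto
          define f3 where "f3 = f2(23 := f2 (nat (f2 22)))"
          have f3: "fold effect [ILoad 23 22] (f2, g2) = (f3, g2)" by (simp add: f3_def)
          have addr: "nat (f2 22) = 64 + (a + k) * L + (b + j)" using K by (intro nat_of_int_add(1)) (simp add: K_def)
          have "J k j (f3, g2)" using K by (auto simp: K_def f3_def intro!: J_same[of k j f2 g2])
          then obtain qs' where qs': "mem qs' f3" "f3 10 = int (queue + 3 * length qs')"
              "extends qs (block s a b k j) qs'"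
            and f3': "g2 = g" "const_regs f3" "f3 9 = f 9" "f3 11 = f 11" "f3 16 = int b"
              "f3 15 = int (a + k)" "f3 17 = int ((a + k) * L)" "f3 20 = int s - int k"
            by (auto simp: J_def)
          have f3'': "f3 22 = int (64 + (a + k) * L + (b + j))" "f3 24 = int (b + j)" "f3 21 = int s - int j"
            using K by (auto simp: K_def f3_def)
          have "f3 23 = f3 (64 + (a + k) * L + (b + j))" by (simp add: f3_def addr)
          then have val: "f3 23 = (if ?p \<in> set qs' then 1 else 0)"
            using qs'(1) p by (simp add: mem_def)
          define R where "R = (\<lambda>(f', g'). J k (Suc j) (f', g') \<and> f' 22 = int (64 + (a + k) * L + (b + j)) \<and>
             f' 24 = int (b + j) \<and> f' 21 = int s - int j)"
          show "wp (UnlI 4 23 (push_com 15 24 17)) 8 R (fold effect [ILoad 23 22] (f2, g2))"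
            unfolding f3
          proof (rule wp_UnlI[where T = 7])
            assume "fst (f3, g2) 4 \<le> fst (f3, g2) 23"
            then have "?p \<in> set qs'" using val f3'(2) by (auto simp: const_regs_def split: if_splits)
            then show "R (f3, g2)"
              using qs' f3' f3'' extends_old[OF qs'(3)] by (auto simp: R_def J_def block_next_column)
          next
            assume "\<not> fst (f3, g2) 4 \<le> fst (f3, g2) 23"
            then have "?p \<notin> set qs'" using val f3'(2) by (auto simp: const_regs_def split: if_splits)
            then have ext: "extends qs (block s a b k (Suc j)) (qs' @ [?p])"
              unfolding block_next_column by (rule extends_new[OF qs'(3)])
            have "wp (push_com 15 24 17) 7 (\<lambda>(f', g'). g' = g2 \<and> mem (qs' @ [?p]) f' \<and>
                f' 10 = int (queue + 3 * length (qs' @ [?p])) \<and> (\<forall>k<64. k \<noteq> 10 \<longrightarrow> f' k = f3 k)) (f3, g2)"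
              using f3'(2) f3'' f3' qs' p by (intro wp_push_com) (auto simp: const_regs_def)
            then show "wp (push_com 15 24 17) 7 R (f3, g2)"
            proof (rule wp_mono)
              show "R \<sigma>" if S: "case \<sigma> of (f', g') \<Rightarrow> g' = g2 \<and> mem (qs' @ [?p]) f' \<and>
                f' 10 = int (queue + 3 * length (qs' @ [?p])) \<and> (\<forall>k<64. k \<noteq> 10 \<longrightarrow> f' k = f3 k)" for \<sigma>
              proof -
                obtain f' where \<sigma>: "\<sigma> = (f', g2)" and m': "mem (qs' @ [?p]) f'"
                  "f' 10 = int (queue + 3 * length (qs' @ [?p]))" and eq: "\<And>k. k < 64 \<Longrightarrow> k \<noteq> 10 \<Longrightarrow> f' k = f3 k"
                  using S by (cases \<sigma>) auto
                have "const_regs f'" using f3'(2) by (simp add: const_regs_def eq)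
                moreover have eqs: "f' 9 = f3 9" "f' 11 = f3 11" "f' 15 = f3 15" "f' 16 = f3 16" "f' 17 = f3 17"
                  "f' 20 = f3 20" "f' 21 = f3 21" "f' 22 = f3 22" "f' 24 = f3 24" by (simp_all add: eq)
                ultimately show ?thesis
                  unfolding \<sigma> R_def J_def prod.case eqs using m' ext f3' f3'' by blast
              qed
            qed simp
          qed simp
          show "wp (Blk [IAdd 22 22 4, IAdd 24 24 4, ISub 21 21 4]) 3 (K k (Suc j)) (f4, g4)"
            if R: "R (f4, g4)" for f4 g4
          proof (rule wp_Blk)
            have "f4 4 = 1" and J4: "J k (Suc j) (f4, g4)" using R by (auto simp: R_def J_def const_regs_def)
            moreover have "J k (Suc j) (f4(22 := x, 24 := y, 21 := z), g4)" for x y z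
              by (rule J_same[OF J4]) simp
            ultimately show "K k (Suc j) (fold effect [IAdd 22 22 4, IAdd 24 24 4, ISub 21 21 4] (f4, g4))"
              using R by (simp add: K_def R_def)
          qed auto
        qed auto
      qed auto
      show "wp (Blk [IAdd 15 15 4, IAdd 17 17 6, ISub 20 20 4]) 3 (J (Suc k) 0) (f2, g2)"
        if "K k s (f2, g2)" for f2 g2
      proof (rule wp_Blk)
        have J2: "J k s (f2, g2)" using that by (simp add: K_def)
        then obtain qs' where qs': "mem qs' f2" "f2 10 = int (queue + 3 * length qs')"
              "extends qs (block s a b (Suc k) 0) qs'"
          by (auto simp: J_def block_next_row)
        have "mem qs' (f2(15 := x, 17 := y, 20 := z))" for x y z
          by (rule mem_same[OF qs'(1)]) simp
        then show "J (Suc k) 0 (fold effect [IAdd 15 15 4, IAdd 17 17 6, ISub 20 20 4] (f2, g2))"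
          using J2 qs'(2,3) by (auto simp: J_def const_regs_def algebra_simps)
      qed auto
    qed auto
  qed (auto simp: J_def algebra_simps)
qed auto



text \<open>The budget adds up as \<open>6 * s + 11\<close> for reading and scaling the pair,
  \<open>19 * s + 12\<close> for the inner product, 1 for the branch, \<open>7 * s + 3\<close> for
  the reduction, 9 for the flag and \<open>s * (14 * s + 11) + 2\<close> for the successors.\<close>

lemma wp_visit_com:
  assumes c: "const_regs f" and t: "table g" and m: "mem qs f"
    and h: "h < length qs" "qs ! h = (a, b)" and ab: "a < L" "b < L"
    and f: "f 9 = int (queue + 3 * h)" "f 10 = int (queue + 3 * length qs)"
  shows "wp visit_com (14 * s * s + 43 * s + 38)
    (\<lambda>(f', g'). const_regs f' \<and> table g' \<and> f' 9 = int (queue + 3 * Suc h) \<and>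
      f' 11 = (if bad_pair a b then 1 else f 11) \<and>
      (\<exists>qs'. mem qs' f' \<and> f' 10 = int (queue + 3 * length qs') \<and>
         extends qs (if word_inner s r \<delta> a b = 0 then {} else block s (a * s mod L) (b * s mod L) s 0) qs')) (f, g)"
  (is "wp _ _ ?Q _")
  unfolding visit_com_def
proof (rule wp_SeqI[OF wp_pop_com[OF c m h f(1)]])
  let ?ip = "word_inner s r \<delta> a b"
  show "14 * s * s + 43 * s + 38 \<ge> 6 * s + 11 + (14 * s * s + 37 * s + 27)" by simp
  fix f1 g1
  assume "case (f1, g1) of (f', g') \<Rightarrow> g' = g \<and> const_regs f' \<and> mem qs f' \<and> f' 9 = int (queue + 3 * Suc h) \<and>
      f' 10 = f 10 \<and> f' 11 = f 11 \<and> f' 12 = int a \<and> f' 13 = int b \<and> f' 15 = int (a * s) \<and>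
      f' 16 = int (b * s) \<and> f' 17 = int (a * s * L)"
  then have g1: "g1 = g" and c1: "const_regs f1" and m1: "mem qs f1"
    and f1: "f1 9 = int (queue + 3 * Suc h)" "f1 10 = int (queue + 3 * length qs)" "f1 11 = f 11"
      "f1 12 = int a" "f1 13 = int b" "f1 15 = int (a * s)" "f1 16 = int (b * s)" "f1 17 = int (a * s * L)"
    using f by auto
  have t1: "table g1" using t g1 by simp
  show "wp (Seq inner_com (UnlR 4 7 (Seq mod_com (Seq flag_com expand_com)))) (14 * s * s + 37 * s + 27) ?Q (f1, g1)"
  proof (rule wp_SeqI[OF wp_inner_com[OF c1 t1 ab f1(6,7)]])
    show "19 * s + 12 + (14 * s * s + 18 * s + 15) \<le> 14 * s * s + 37 * s + 27" by simp
    fix f2 g2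
    assume "case (f2, g2) of (f', g') \<Rightarrow> same_except {18, 19, 20} f1 f' \<and> table g' \<and> (g' 4 \<le> g' 7) = (?ip = 0)"
    then have same: "\<And>k. k \<notin> {18, 19, 20} \<Longrightarrow> f2 k = f1 k" and t2: "table g2"
      and ip: "g2 4 \<le> g2 7 \<longleftrightarrow> ?ip = 0" by (auto simp: same_except_def)
    have c2: "const_regs f2" using c1 by (simp add: const_regs_def same)
    have m2: "mem qs f2" by (rule mem_same[OF m1]) (simp add: same)
    have f2: "f2 9 = int (queue + 3 * Suc h)" "f2 10 = int (queue + 3 * length qs)" "f2 11 = f 11"
      "f2 12 = int a" "f2 13 = int b" "f2 15 = int (a * s)" "f2 16 = int (b * s)" "f2 17 = int (a * s * L)"
      using f1 same by simp_all
    show "wp (UnlR 4 7 (Seq mod_com (Seq flag_com expand_com))) (14 * s * s + 18 * s + 15) ?Q (f2, g2)"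
    proof (rule wp_UnlR[where T = "14 * s * s + 18 * s + 14"])
      assume "snd (f2, g2) 4 \<le> snd (f2, g2) 7"
      then have "?ip = 0" using ip by simp
      \<comment> \<open>An orthogonal pair is never bad and has no outgoing edges, so skipping the
        rest leaves flag and queue right.\<close>
      then show "?Q (f2, g2)"
        using c2 t2 m2 f2 extends_empty by (auto simp: bad_pair_def)
    next
      assume "\<not> snd (f2, g2) 4 \<le> snd (f2, g2) 7"
      then have ne: "?ip \<noteq> 0" using ip by simp
      show "wp (Seq mod_com (Seq flag_com expand_com)) (14 * s * s + 18 * s + 14) ?Q (f2, g2)"
      proof (rule wp_SeqI[OF wp_mod_com[OF c2 ab f2(6-8)]])
        show "7 * s + 3 + (14 * s * s + 11 * s + 11) \<le> 14 * s * s + 18 * s + 14" by simp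
        fix f3 g3
        let ?a = "a * s mod L" and ?b = "b * s mod L"
        assume "case (f3, g3) of (f', g') \<Rightarrow> g' = g2 \<and> same_except {15, 16, 17, 25} f2 f' \<and> f' 15 = int ?a \<and>
          f' 16 = int ?b \<and> f' 17 = int (?a * L)"
        then have g3: "g3 = g2" and same3: "\<And>k. k \<notin> {15, 16, 17, 25} \<Longrightarrow> f3 k = f2 k"
          and f3: "f3 15 = int ?a" "f3 16 = int ?b" "f3 17 = int (?a * L)" by (auto simp: same_except_def)
        have f3': "f3 12 = int a" "f3 13 = int b" using f2 same3 by simp_all
        show "wp (Seq flag_com expand_com) (14 * s * s + 11 * s + 11) ?Q (f3, g3)"
        proof (rule wp_SeqI[OF wp_flag_com[OF f3' f3(1,2)]])
          show "9 + (s * (14 * s + 11) + 2) \<le> 14 * s * s + 11 * s + 11" by (simp add: algebra_simps)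
          fix f4 g4
          assume "case (f4, g4) of (f', g') \<Rightarrow> g' = g3 \<and> same_except {11, 26, 27, 28} f3 f' \<and>
            f' 11 = (if a \<noteq> b \<and> ?a = ?b then 1 else f3 11)"
          then have g4: "g4 = g2" and same4: "\<And>k. k \<notin> {11, 26, 27, 28} \<Longrightarrow> f4 k = f3 k"
            and "f4 11 = (if a \<noteq> b \<and> ?a = ?b then 1 else f3 11)" using g3 by (auto simp: same_except_def)
          moreover have "f3 11 = f 11" using same3 f2 by simp
          ultimately have flag: "f4 11 = (if bad_pair a b then 1 else f 11)" using ne by (simp add: bad_pair_def)
          have c4: "const_regs f4" using c2 by (simp add: const_regs_def same3 same4)
          have m4: "mem qs f4" by (rule mem_same[OF m2]) (simp add: same3 same4)
          have f4: "f4 10 = int (queue + 3 * length qs)" "f4 15 = int ?a" "f4 16 = int ?b" "f4 17 = int (?a * L)"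
            "f4 9 = int (queue + 3 * Suc h)"
            using f2 f3 same3 same4 by simp_all
          show "wp expand_com (s * (14 * s + 11) + 2) ?Q (f4, g4)"
          proof (rule wp_mono[OF wp_expand_com[OF c4 m4 shifted_add_less shifted_add_less f4(1-4)]])
            show "?Q \<sigma>" if "case \<sigma> of (f', g') \<Rightarrow> g' = g4 \<and> const_regs f' \<and> f' 9 = f4 9 \<and> f' 11 = f4 11 \<and>
              (\<exists>qs'. mem qs' f' \<and> f' 10 = int (queue + 3 * length qs') \<and> extends qs (block s ?a ?b s 0) qs')" for \<sigma>
              using that ne flag f4(5) t2 g4 by (cases \<sigma>) auto
          qed auto
        qed
      qed
    qed simp
  qed
qed

section \<open>Correctness of the breadth-first search\<close>

definition bfs_invariant :: "nat \<Rightarrow> (nat \<times> nat) list \<Rightarrow> bool" where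
  "bfs_invariant h qs \<longleftrightarrow> h \<le> length qs \<and> distinct qs \<and>
     (\<forall>a b. (a, b) \<in> set qs \<longrightarrow> pair_reach s r \<delta> a b) \<and> (\<forall>a<L. (a, a) \<in> set qs) \<and>
     (\<forall>j<h. \<forall>a b. qs ! j = (a, b) \<longrightarrow> word_inner s r \<delta> a b \<noteq> 0 \<longrightarrow>
        block s (a * s mod L) (b * s mod L) s 0 \<subseteq> set qs)"

lemma pair_reach_less: "pair_reach s r \<delta> a b \<Longrightarrow> a < L \<and> b < L"
  by (induction rule: pair_reach.induct) (auto simp: shifted_add_less)

text \<open>The list holds all pairs ever found, of which the first \<open>h\<close> are expanded.
  The new entry at \<open>h\<close> gets its successors from \<open>extends\<close>; for the earlier
  ones closure persists because the list only grows.\<close>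

lemma bfs_invariant_step:
  assumes inv: "bfs_invariant h qs" and h: "h < length qs" "qs ! h = (a, b)"
    and ext: "extends qs (if word_inner s r \<delta> a b = 0 then {} else block s (a * s mod L) (b * s mod L) s 0) qs'"
  shows "bfs_invariant (Suc h) qs'"
proof -
  let ?S = "if word_inner s r \<delta> a b = 0 then {} else block s (a * s mod L) (b * s mod L) s 0"
  obtain zs where zs: "qs' = qs @ zs" "set zs \<subseteq> ?S" using ext by (auto simp: extends_def)
  have S: "?S \<subseteq> set qs'" using ext by (simp add: extends_def)
  have "pair_reach s r \<delta> a b" using inv h by (metis bfs_invariant_def nth_mem)
  then have "pair_reach s r \<delta> x y" if "(x, y) \<in> ?S" for x y
    using that pair_reach.step[of s r \<delta> a b] by (auto simp: block_def split: if_splits)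
  then have "\<forall>x y. (x, y) \<in> set qs' \<longrightarrow> pair_reach s r \<delta> x y"
    using inv zs by (auto simp: bfs_invariant_def)
  moreover have "block s (x * s mod L) (y * s mod L) s 0 \<subseteq> set qs'"
    if "j < Suc h" "qs' ! j = (x, y)" "word_inner s r \<delta> x y \<noteq> 0" for j x y
  proof (cases "j = h")
    case True
    then show ?thesis using that h zs(1) S by (simp add: nth_append)
  next
    case False
    then have "j < h" "qs ! j = (x, y)" using that h(1) zs(1) by (auto simp: nth_append)
    then show ?thesis using inv that(3) zs(1) unfolding bfs_invariant_def by fastforce
  qed
  moreover have "distinct qs'" using inv ext by (simp add: bfs_invariant_def extends_def)
  moreover have "\<forall>a<L. (a, a) \<in> set qs'" "Suc h \<le> length qs'" using inv h zs(1) by (auto simp: bfs_invariant_def)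
  ultimately show ?thesis unfolding bfs_invariant_def by blast
qed

text \<open>Once every entry is expanded, the list contains the diagonal and is closed under edges,
  hence contains everything reachable by rule induction.\<close>

lemma bfs_invariant_complete:
  assumes inv: "bfs_invariant (length qs) qs"
  shows "(a, b) \<in> set qs \<longleftrightarrow> pair_reach s r \<delta> a b"
proof
  show "pair_reach s r \<delta> a b" if "(a, b) \<in> set qs" using that inv by (simp add: bfs_invariant_def)
  show "(a, b) \<in> set qs" if "pair_reach s r \<delta> a b"
    using that
  proof induction
    case (diag a)
    then show ?case using inv by (simp add: bfs_invariant_def)
  next
    case (step a b x y)
    then obtain j where "j < length qs" "qs ! j = (a, b)" by (metis in_set_conv_nth)
    then have "block s (a * s mod L) (b * s mod L) s 0 \<subseteq> set qs"
      using inv step.hyps(2) by (simp add: bfs_invariant_def)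
    moreover have "(a * s mod L + x, b * s mod L + y) \<in> block s (a * s mod L) (b * s mod L) s 0"
      using step.hyps by (auto simp: block_def)
    ultimately show ?case by blast
  qed
qed

text \<open>Distinct reachable pairs lie in an \<open>L\<close> by \<open>L\<close> square. This
  bounds the number of visits and so yields both termination and the running time.\<close>

lemma bfs_invariant_length:
  assumes inv: "bfs_invariant h qs"
  shows "length qs \<le> L * L"
proof -
  have "set qs \<subseteq> {..<L} \<times> {..<L}" using inv pair_reach_less by (auto simp: bfs_invariant_def)
  then have "card (set qs) \<le> card ({..<L} \<times> {..<L})" by (intro card_mono) auto
  then show ?thesis using inv by (simp add: bfs_invariant_def distinct_card card_cartesian_product)
qed

lemma wp_loop_com:
  assumes c: "const_regs f" and t: "table g" and m: "mem (map (\<lambda>a. (a, a)) [0..<L]) f"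
    and f: "f 9 = int queue" "f 10 = int (queue + 3 * L)" "f 11 = 0"
  shows "wp (Whl 10 9 visit_com) (L * L * (14 * s * s + 43 * s + 40) + 1)
    (\<lambda>(f', g'). f' 4 = 1 \<and> f' 11 = (if \<exists>a b. pair_reach s r \<delta> a b \<and> bad_pair a b then 1 else 0)) (f, g)"
proof -
  \<comment> \<open>The variant \<open>L * L - h\<close> counts the visits still possible, since
    each visit advances the head and at most \<open>L * L\<close> pairs ever enter the
    queue.\<close>
  define I where "I n = (\<lambda>(f', g'). \<exists>h qs. bfs_invariant h qs \<and> n = L * L - h \<and> const_regs f' \<and> table g' \<and> mem qs f' \<and>
    f' 9 = int (queue + 3 * h) \<and> f' 10 = int (queue + 3 * length qs) \<and>
    f' 11 = (if \<exists>j<h. \<exists>a b. qs ! j = (a, b) \<and> bad_pair a b then 1 else 0))" for n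
  show ?thesis
  proof (rule wp_Whl[where I = I and n = "L * L" and T = "14 * s * s + 43 * s + 38"])
    have "bfs_invariant 0 (map (\<lambda>a. (a, a)) [0..<L])"
      by (auto simp: bfs_invariant_def distinct_map inj_on_def intro: pair_reach.diag)
    then show "I (L * L) (f, g)" unfolding I_def prod.case
      by (intro exI[of _ 0] exI[of _ "map (\<lambda>a. (a, a)) [0..<L]"]) (use c t m f in simp)
  next
    fix n and \<sigma> :: store
    assume I: "I n \<sigma>" and le: "fst \<sigma> 10 \<le> fst \<sigma> 9"
    obtain f' g' where \<sigma>: "\<sigma> = (f', g')" by fastforce
    obtain h qs where inv: "bfs_invariant h qs" and c': "const_regs f'"
      and f': "f' 9 = int (queue + 3 * h)" "f' 10 = int (queue + 3 * length qs)"
        "f' 11 = (if \<exists>j<h. \<exists>a b. qs ! j = (a, b) \<and> bad_pair a b then 1 else 0)"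
      using I unfolding I_def \<sigma> by auto
    have "length qs \<le> h" using le f' by (simp add: \<sigma>)
    then have h: "h = length qs" using inv by (simp add: bfs_invariant_def)
    have "(\<exists>j<h. \<exists>a b. qs ! j = (a, b) \<and> bad_pair a b) \<longleftrightarrow> (\<exists>a b. (a, b) \<in> set qs \<and> bad_pair a b)"
      unfolding h by (metis in_set_conv_nth)
    also have "\<dots> \<longleftrightarrow> (\<exists>a b. pair_reach s r \<delta> a b \<and> bad_pair a b)"
      using bfs_invariant_complete inv unfolding h by blast
    finally show "case \<sigma> of (f', g') \<Rightarrow>
      f' 4 = 1 \<and> f' 11 = (if \<exists>a b. pair_reach s r \<delta> a b \<and> bad_pair a b then 1 else 0)"
      using f'(3) c' by (simp add: \<sigma> const_regs_def)
  next
    fix n and \<sigma> :: store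
    assume I: "I n \<sigma>" and gt: "\<not> fst \<sigma> 10 \<le> fst \<sigma> 9"
    obtain f' g' where \<sigma>: "\<sigma> = (f', g')" by fastforce
    obtain h qs where inv: "bfs_invariant h qs" and n: "n = L * L - h" and c': "const_regs f'"
      and t': "table g'" and m': "mem qs f'"
      and f': "f' 9 = int (queue + 3 * h)" "f' 10 = int (queue + 3 * length qs)"
        "f' 11 = (if \<exists>j<h. \<exists>a b. qs ! j = (a, b) \<and> bad_pair a b then 1 else 0)"
      using I unfolding I_def \<sigma> by auto
    have h: "h < length qs" using gt f' by (simp add: \<sigma>)
    obtain a b where ab: "qs ! h = (a, b)" by fastforce
    have "pair_reach s r \<delta> a b" using inv h ab by (metis bfs_invariant_def nth_mem)
    then have lt: "a < L" "b < L" using pair_reach_less by auto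
    have "0 < n" using n h bfs_invariant_length[OF inv] by linarith
    moreover have "wp visit_com (14 * s * s + 43 * s + 38) (I (n - 1)) \<sigma>"
      unfolding \<sigma>
    proof (rule wp_mono[OF wp_visit_com[OF c' t' m' h ab lt f'(1,2)]])
      fix \<sigma>'
      assume post: "case \<sigma>' of (f'', g'') \<Rightarrow> const_regs f'' \<and> table g'' \<and> f'' 9 = int (queue + 3 * Suc h) \<and>
        f'' 11 = (if bad_pair a b then 1 else f' 11) \<and>
        (\<exists>qs'. mem qs' f'' \<and> f'' 10 = int (queue + 3 * length qs') \<and>
         extends qs (if word_inner s r \<delta> a b = 0 then {} else block s (a * s mod L) (b * s mod L) s 0) qs')"
      obtain f'' g'' where \<sigma>': "\<sigma>' = (f'', g'')" by fastforce
      obtain qs' where q: "mem qs' f''" "f'' 10 = int (queue + 3 * length qs')" and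
         ext: "extends qs (if word_inner s r \<delta> a b = 0 then {} else block s (a * s mod L) (b * s mod L) s 0) qs'"
        using post by (auto simp: \<sigma>')
      have inv': "bfs_invariant (Suc h) qs'" by (rule bfs_invariant_step[OF inv h ab ext])
      obtain zs where zs: "qs' = qs @ zs" using ext by (auto simp: extends_def)
      \<comment> \<open>Pairs already visited keep their indices, so the flag remains a statement
        about the first entries of the longer queue.\<close>
      have nth: "qs' ! j = qs ! j" if "j \<le> h" for j using that h by (simp add: zs nth_append)
      have "(\<exists>j<Suc h. \<exists>x y. qs' ! j = (x, y) \<and> bad_pair x y) \<longleftrightarrow>
          bad_pair a b \<or> (\<exists>j<h. \<exists>x y. qs ! j = (x, y) \<and> bad_pair x y)"
        using nth ab by (auto simp: less_Suc_eq)
      then have flag: "f'' 11 = (if \<exists>j<Suc h. \<exists>x y. qs' ! j = (x, y) \<and> bad_pair x y then 1 else 0)"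
        using post f'(3) by (auto simp: \<sigma>')
      have "n - 1 = L * L - Suc h" using n by simp
      then show "I (n - 1) \<sigma>'"
        using inv' q flag post unfolding I_def \<sigma>' prod.case by blast
    qed simp
    ultimately show "0 < n \<and> wp visit_com (14 * s * s + 43 * s + 38) (I (n - 1)) \<sigma>" by simp
  qed (simp add: algebra_simps)
qed

end

section \<open>Total running time and the complete program\<close>

lemma double_Suc_less: "u < v \<Longrightarrow> 2 * u + 1 < 2 * (v::nat)"
  by simp

context lqca_store
begin

text \<open>Here \<open>X\<close> is n^2, and every monomial is at most \<open>X\<close>, being a
  product of two quantities bounded by \<open>s * L\<close>; for \<open>r\<close> this uses
  \<open>r \<le> L\<close>. The coefficients then add up to 162, below the constant 197.\<close>

lemma main_time_bound:
  "r * (4 * s + 7) + 3 + (4 * L + 4 * s + 5 + (6 * base + 4 + (13 * L + 7 +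
     (L * L * (14 * s * s + 43 * s + 40) + 1 + 1)))) \<le> 197 * (s ^ (r + 1))\<^sup>2"
proof -
  define X where "X = (s * L) * (s * L)"
  have s: "1 \<le> s" using s_pos by simp
  have L: "1 \<le> L" using s_le_L s by linarith
  have X: "u * v \<le> X" if "u \<le> s * L" "v \<le> s * L" for u v
    using mult_le_mono[OF that] by (simp add: X_def)
  have sL: "1 \<le> s * L" "s \<le> s * L" "L \<le> s * L" "r \<le> s * L"
    using mult_le_mono[OF s L] mult_le_mono[OF s order_refl[of L]] mult_le_mono[OF order_refl[of s] L] r_le_L
    unfolding mult_1 mult_1_right by linarith+
  have "r * s \<le> X" "r \<le> X" "1 \<le> X" "L \<le> X" "s \<le> X" "s * L \<le> X" "L * L \<le> X" "L * (s * L) \<le> X"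
    using X[OF sL(4,2)] X[OF sL(4,1)] X[OF sL(1,1)] X[OF sL(3,1)] X[OF sL(2,1)] X[OF order_refl sL(1)]
      X[OF sL(3,3)] X[OF sL(3) order_refl]
    by (simp_all only: mult_1_right)
  moreover have "r * (4 * s + 7) = 4 * (r * s) + 7 * r" "base = 2 * (s * L)"
    "L * L * (14 * s * s + 43 * s + 40) = 14 * X + 43 * (L * (s * L)) + 40 * (L * L)"
    by (simp_all add: X_def algebra_simps)
  moreover have "(s ^ (r + 1))\<^sup>2 = X" by (simp add: X_def power2_eq_square)
  ultimately show ?thesis by linarith
qed

lemma wp_main_com:
  assumes f: "f 0 = int s" "f 1 = int r" "f 4 = 1" "\<And>k. k > 4 \<Longrightarrow> f k = 0"
    and g: "\<And>a x. a < L \<Longrightarrow> x < s \<Longrightarrow> g (2 * (a * s + x)) = Re (\<delta> (digits s r a) x) \<and>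
      g (2 * (a * s + x) + 1) = Im (\<delta> (digits s r a) x)"
  shows "wp main_com (197 * (s ^ (r + 1))\<^sup>2)
    (\<lambda>(f', g'). f' 0 = (if \<exists>a b. pair_reach s r \<delta> a b \<and> bad_pair a b then 0 else 1)) (f, g)"
  (is "wp _ _ ?Q _")
proof (rule wp_mono[OF _ main_time_bound])
  let ?bad = "if \<exists>a b. pair_reach s r \<delta> a b \<and> bad_pair a b then 1 else 0 :: int"
  let ?T5 = "L * L * (14 * s * s + 43 * s + 40) + 1 + 1"
  let ?T4 = "13 * L + 7 + ?T5"
  let ?T3 = "6 * base + 4 + ?T4"
  let ?T2 = "4 * L + 4 * s + 5 + ?T3"
  show "wp main_com (r * (4 * s + 7) + 3 + ?T2) ?Q (f, g)"
    unfolding main_com_def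
  proof (rule wp_SeqI[OF wp_pow_com])
    fix f1 g1
    assume "case (f1, g1) of (f', g') \<Rightarrow> g' = g \<and> same_except {6, 15, 20, 21} f f' \<and> f' 6 = int L"
    then have g1: "g1 = g" and same1: "\<And>k. k \<notin> {6, 15, 20, 21} \<Longrightarrow> f1 k = f k" and L1: "f1 6 = int L"
      by (auto simp: same_except_def)
    have f1: "f1 0 = int s" "f1 4 = 1" "f1 5 = 0" "f1 7 = 0" "f1 8 = 0" "f1 11 = 0" "\<And>k. 64 \<le> k \<Longrightarrow> f1 k = 0"
      using f same1 by simp_all
    show "wp (Seq sizes_com (Seq copy_com (Seq seed_com (Seq (Whl 10 9 visit_com) (Blk [ISub 0 4 11])))))
      ?T2 ?Q (f1, g1)"
    proof (rule wp_SeqI[OF wp_sizes_com])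
      fix f2 g2
      assume "case (f2, g2) of (f', g') \<Rightarrow> g' = g1 \<and> same_except {7, 8, 15, 20} f1 f' \<and>
        f' 7 = int (L * L) \<and> f' 8 = int base"
      then have g2: "g2 = g" and same2: "\<And>k. k \<notin> {7, 8, 15, 20} \<Longrightarrow> f2 k = f1 k"
        and sz: "f2 7 = int (L * L)" "f2 8 = int base"
        using g1 by (auto simp: same_except_def)
      have c2: "const_regs f2" using sz f1 L1 by (simp add: const_regs_def same2)
      show "wp (Seq copy_com (Seq seed_com (Seq (Whl 10 9 visit_com) (Blk [ISub 0 4 11])))) ?T3 ?Q (f2, g2)"
      proof (rule wp_SeqI[OF wp_copy_com])
        show "f2 8 = int base" "f2 4 = 1" "0 < base" using c2 s_pos by (simp_all add: const_regs_def)
        fix f3 g3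
        assume "case (f3, g3) of (f', g') \<Rightarrow> same_except {15, 20} f2 f' \<and> (\<forall>j<base. g' (base + j) = g2 j)"
        then have same3: "\<And>k. k \<notin> {15, 20} \<Longrightarrow> f3 k = f2 k" and copy: "\<And>j. j < base \<Longrightarrow> g3 (base + j) = g j"
          using g2 by (auto simp: same_except_def)
        have c3: "const_regs f3" using c2 by (simp add: const_regs_def same3)
        \<comment> \<open>Integer registers from 64 on are initially 0 and still untouched, so the
          table of marks starts out empty without being cleared.\<close>
        have m3: "mem [] f3" using f1(7) by (simp add: mem_def same3 same2)
        have t3: "table g3"
          unfolding table_def
        proof (intro allI impI)
          fix a x assume ax: "a < L" "x < s"
          then have "a * s + x < Suc a * s" by simp
          also have "\<dots> \<le> L * s" using ax by (intro mult_le_mono1) simp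
          \<comment> \<open>The bound is stated for the odd index, that of the imaginary part, so
            that both parts of the entry lie in the copied range.\<close>
          finally have lt: "2 * (a * s + x) + 1 < base"
            unfolding mult.commute[of L s] mult.assoc[of 2] by (rule double_Suc_less)
          then show "g3 (base + 2 * (a * s + x)) = Re (\<delta> (digits s r a) x) \<and>
            g3 (base + 2 * (a * s + x) + 1) = Im (\<delta> (digits s r a) x)"
            using copy[of "2 * (a * s + x)"] copy[of "2 * (a * s + x) + 1"] g[OF ax] by (simp add: add.assoc)
        qed
        have f11: "f3 11 = 0" using f1 by (simp add: same3 same2)
        show "wp (Seq seed_com (Seq (Whl 10 9 visit_com) (Blk [ISub 0 4 11]))) ?T4 ?Q (f3, g3)"
        proof (rule wp_SeqI[OF wp_seed_com[OF c3 m3]])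
          fix f4 g4
          assume S: "case (f4, g4) of (f', g') \<Rightarrow> g' = g3 \<and> const_regs f' \<and> f' 9 = int queue \<and>
            f' 10 = int (queue + 3 * L) \<and> f' 11 = f3 11 \<and> mem (map (\<lambda>a. (a, a)) [0..<L]) f'"
          show "wp (Seq (Whl 10 9 visit_com) (Blk [ISub 0 4 11])) ?T5 ?Q (f4, g4)"
          proof (rule wp_SeqI[OF wp_loop_com])
            show "wp (Blk [ISub 0 4 11]) 1 ?Q (f5, g5)"
              if "case (f5, g5) of (f', g') \<Rightarrow> f' 4 = 1 \<and> f' 11 = ?bad" for f5 g5
              by (rule wp_Blk) (use that in auto)
          qed (use S t3 f11 in auto)
        qed simp
      qed simp
    qed (use f1 L1 in simp_all)
  qed (use f in simp_all)
qed

end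

lemma program_correct:
  assumes "wp main_com T (\<lambda>(f', g'). f' 0 = v) (f(4 := 1), g)" "f 0 > 1"
  shows "\<exists>k \<le> T + 2. halted program ((step program ^^ k) (mstate_at 0 (f, g))) \<and>
    ireg ((step program ^^ k) (mstate_at 0 (f, g))) 0 = v"
proof -
  let ?c = "Seq (Blk [ISet 4 1]) (UnlI 0 4 main_com)"
  have "wp ?c (T + 2) (\<lambda>(f', g'). f' 0 = v) (f, g)"
    by (rule wp_Blk_Seq, simp, rule wp_UnlI[where T = T]) (use assms in auto)
  then obtain k \<sigma> where k: "k \<le> T + 2" "runs ?c (f, g) k \<sigma>" "fst \<sigma> 0 = v" by (auto simp: wp_def)
  have "(step program ^^ k) (mstate_at 0 (f, g)) = mstate_at (length program) \<sigma>"
    using k(2)[unfolded runs_def, rule_format, of "[]" "[]"] by (simp add: program_def)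
  then show ?thesis using k by (intro exI[of _ k]) (simp add: halted_def mstate_at_def)
qed

lemma program_single_state:
  assumes "f 0 = 1"
  shows "\<exists>k \<le> 2. halted program ((step program ^^ k) (mstate_at 0 (f, g))) \<and>
    ireg ((step program ^^ k) (mstate_at 0 (f, g))) 0 = 1"
proof -
  let ?c = "Seq (Blk [ISet 4 1]) (UnlI 0 4 main_com)"
  have "runs ?c (f, g) (length [ISet 4 1] + 1) (fold effect [ISet 4 1] (f, g))"
    by (rule runs_Seq[OF runs_Blk runs_UnlI_skip]) (use assms in auto)
  then have "(step program ^^ 2) (mstate_at 0 (f, g)) = mstate_at (length program) (f(4 := 1), g)"
    unfolding runs_def by (drule_tac x = "[]" in spec, drule_tac x = "[]" in spec)
      (simp add: program_def numeral_2_eq_2)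
  then show ?thesis using assms by (intro exI[of _ 2]) (simp add: halted_def mstate_at_def)
qed

lemma columns_orthogonal_single_state: "columns_orthogonal 1 q N \<delta>"
proof -
  have "c = c'" if "c \<in> configs 1 q" "c' \<in> configs 1 q" for c c'
    using that by (auto simp: configs_def is_config_def fun_eq_iff)
  then show ?thesis unfolding columns_orthogonal_def by blast
qed

theorem theorem5:
  "\<exists>(P :: instr list) (C :: nat).
     \<forall>s q N \<delta>. lqca s q N \<delta> \<and> simple_nbhd N \<longrightarrow>
       (\<exists>k \<le> C * (s ^ (length N + 1))^2.
          halted P ((step P ^^ k) (init_state s q N \<delta>)) \<and>
          (ireg ((step P ^^ k) (init_state s q N \<delta>)) 0 = 1 \<longleftrightarrow> columns_orthogonal s q N \<delta>))"
proof (rule exI[of _ program], rule exI[of _ 199], intro allI impI)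
  fix s q N and \<delta> :: "nat list \<Rightarrow> nat \<Rightarrow> complex"
  assume A: "lqca s q N \<delta> \<and> simple_nbhd N"
  define f where "f = ireg (init_state s q N \<delta>)"
  define g where "g = rreg (init_state s q N \<delta>)"
  define r where "r = length N"
  have init: "init_state s q N \<delta> = mstate_at 0 (f, g)"
    by (simp add: f_def g_def mstate_at_def init_state_def)
  have s: "0 < s" using A by (simp add: lqca_def)
  then have n: "1 \<le> (s ^ (r + 1))\<^sup>2" by simp
  have f: "f 0 = int s" "f 1 = int r" "\<And>k. k > 4 \<Longrightarrow> f k = 0"
    by (auto simp: f_def init_state_def r_def)
  show "\<exists>k \<le> 199 * (s ^ (length N + 1))^2.
          halted program ((step program ^^ k) (init_state s q N \<delta>)) \<and>
          (ireg ((step program ^^ k) (init_state s q N \<delta>)) 0 = 1 \<longleftrightarrow> columns_orthogonal s q N \<delta>)"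
  \<comment> \<open>With one letter the bound is constant however large \<open>r\<close> is. There
    is only one configuration then, and the input register 0 already shows the answer.\<close>
  proof (cases "s = 1")
    case True
    then obtain k where "k \<le> 2" "halted program ((step program ^^ k) (init_state s q N \<delta>))"
      "ireg ((step program ^^ k) (init_state s q N \<delta>)) 0 = 1"
      using program_single_state[of f g] f(1) unfolding init by auto
    moreover have "columns_orthogonal s q N \<delta>" using True columns_orthogonal_single_state by simp
    ultimately show ?thesis using True by (intro exI[of _ k]) simp
  next
    case False
    interpret lqca_store s q r \<delta>
    proof
      show "q < s" "0 < r" "2 \<le> s" using A s False by (auto simp: lqca_def simple_nbhd_def r_def)
      show "sqrt (\<Sum>x<s. (cmod (\<delta> w x))^2) > 0" if "length w = r" "set w \<subseteq> {..<s}" for w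
        using A that unfolding lqca_def r_def by blast
      show "\<delta> (replicate r q) x = (if x = q then 1 else 0)" if "x < s" for x
        using A that unfolding lqca_def r_def by blast
    qed
    have N: "N = map (\<lambda>k. hd N + int k) [0..<r]"
      using A simple_nbhd_eq_interval unfolding lqca_def r_def by blast
    have tab: "g (2 * (a * s + x)) = Re (\<delta> (digits s r a) x) \<and> g (2 * (a * s + x) + 1) = Im (\<delta> (digits s r a) x)"
      if "a < L" "x < s" for a x
    proof -
      have "a * s + x < Suc a * s" using that by simp
      also have "\<dots> \<le> L * s" using that by (intro mult_le_mono1) simp
      finally have "2 * (a * s + x) + 1 < 2 * s ^ (r + 1)"
        unfolding mult.commute[of L s] power_add power_one_right by (intro double_Suc_less) (simp add: mult.commute)
      moreover have "(a * s + x) div s = a" "(a * s + x) mod s = x" using that by auto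
      ultimately show ?thesis by (simp add: g_def init_state_def r_def[symmetric] Let_def)
    qed
    have "wp main_com (197 * (s ^ (r + 1))\<^sup>2)
      (\<lambda>(f', g'). f' 0 = (if \<exists>a b. pair_reach s r \<delta> a b \<and> bad_pair a b then 0 else 1)) (f(4 := 1), g)"
      using f tab by (intro wp_main_com) auto
    moreover have "f 0 > 1" using f(1) two_states by simp
    ultimately obtain k where k: "k \<le> 197 * (s ^ (r + 1))\<^sup>2 + 2"
        "halted program ((step program ^^ k) (init_state s q N \<delta>))"
      "ireg ((step program ^^ k) (init_state s q N \<delta>)) 0
        = (if \<exists>a b. pair_reach s r \<delta> a b \<and> bad_pair a b then 0 else 1)"
      using program_correct unfolding init by blast
    moreover have "columns_orthogonal s q N \<delta> \<longleftrightarrow> \<not> (\<exists>a b. pair_reach s r \<delta> a b \<and> bad_pair a b)"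
      by (rule columns_orthogonal_iff[OF N])
    \<comment> \<open>The two steps spent on setting register 4 and testing for one letter are
      absorbed by n^2, which is at least 1; hence 197 + 2.\<close>
    moreover have "k \<le> 199 * (s ^ (length N + 1))\<^sup>2" using k(1) n unfolding r_def by linarith
    ultimately show ?thesis by (intro exI[of _ k]) auto
  qed
qed

end
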